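(* Let $f,g:[-1,1]\to\mathbb{R}$ be continuous functions which are the isotropic parts of positive definite kernels on the unit circle $S^1$, with Fourier--Jacobi series representations $$f(t)=\sum_{k=0}^\infty a_k(f)P_k^{(-1/2,-1/2)}(t),\qquad g(t)=\sum_{k=0}^\infty a_k(g)P_k^{(-1/2,-1/2)}(t),\qquad t\in[-1,1],$$ where all coefficients are nonnegative and both series converge at $t=1$. Then the product $fg$ is the isotropic part of a strictly positive definite kernel on $S^1$ if, and only if, the set $$\{\pm k\pm l:\ k,l\in\mathbb{Z}_+,\ a_k(f)a_l(g)>0\}\subset\mathbb{Z}$$ (all four sign choices are included) intersects every full arithmetic progression in $\mathbb{Z}$.
   Context: $S^1$ is the unit circle in $\mathbb{R}^2$. Its geodesic distance is normalized so that the largest distance $|xy|$ equals $2\pi$; thus $\cos(|xy|/2)=x\cdot y$, the usual inner product. A continuous function $f:[-1,1]\to\mathbb{R}$ is called the isotropic part of the kernel $K(x,y)=f(\cos(|xy|/2))$, $x,y\in S^1$. The kernel $K$ is positive definite if $\sum_{i,j=1}^n c_ic_jK(x_i,x_j)\ge 0$ for all $n\geq 1$, all distinct points $x_1,\dots,x_n\in S^1$ and all real $c_1,\dots,c_n$; it is strictly positive definite if in addition the inequality is strict whenever $c_1,\dots,c_n$ are not all zero. By Schoenberg's theorem, a continuous $f$ is the isotropic part of a positive definite kernel on $S^1$ if and only if it has a (unique) representation $f(t)=\sum_{k\ge0}a_k(f)P_k^{(-1/2,-1/2)}(t)$ with all $a_k(f)\ge 0$ and the series convergent at $t=1$. Here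 $P_k^{(\alpha,\beta)}$ is the Jacobi polynomial of degree $k$; $P_k^{(-1/2,-1/2)}$ is a positive multiple of the Chebyshev polynomial $T_k(t)=\cos(k\arccos t)$. A full arithmetic progression in $\mathbb{Z}$ is a set $n\mathbb{Z}+j=\{nl+j: l\in\mathbb{Z}\}$ with $n,j\in\mathbb{N}$ and $n\ge 2$. $\mathbb{Z}_+$ is the set of nonnegative integers. *)

theory Defs
  imports "HOL-Analysis.Analysis"
begin

abbreviation unit_circle :: "(real ^ 2) set" where
  "unit_circle \<equiv> sphere 0 1"

text \<open>Arc length on the unit circle is the angle \<open>arccos (x \<bullet> y)\<close>; the factor 2 normalizes the
  diameter to \<open>2\<pi>\<close>.\<close>

definition geodesic_dist :: "real ^ 2 \<Rightarrow> real ^ 2 \<Rightarrow> real" where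
  "geodesic_dist x y = 2 * arccos (x \<bullet> y)"

definition isotropic_kernel :: "(real \<Rightarrow> real) \<Rightarrow> real ^ 2 \<Rightarrow> real ^ 2 \<Rightarrow> real" where
  "isotropic_kernel f x y = f (cos (geodesic_dist x y / 2))"

definition positive_definite :: "(real ^ 2 \<Rightarrow> real ^ 2 \<Rightarrow> real) \<Rightarrow> bool" where
  "positive_definite K \<longleftrightarrow>
     (\<forall>n::nat. n \<ge> 1 \<longrightarrow>
       (\<forall>(x :: nat \<Rightarrow> real ^ 2) (c :: nat \<Rightarrow> real).
          inj_on x {1..n} \<longrightarrow> x ` {1..n} \<subseteq> unit_circle \<longrightarrow>
          (\<Sum>i=1..n. \<Sum>j=1..n. c i * c j * K (x i) (x j)) \<ge> 0))"

definition strictly_positive_definite :: "(real ^ 2 \<Rightarrow> real ^ 2 \<Rightarrow> real) \<Rightarrow> bool" where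
  "strictly_positive_definite K \<longleftrightarrow>
     positive_definite K \<and>
     (\<forall>n::nat. n \<ge> 1 \<longrightarrow>
       (\<forall>(x :: nat \<Rightarrow> real ^ 2) (c :: nat \<Rightarrow> real).
          inj_on x {1..n} \<longrightarrow> x ` {1..n} \<subseteq> unit_circle \<longrightarrow>
          (\<exists>i\<in>{1..n}. c i \<noteq> 0) \<longrightarrow>
          (\<Sum>i=1..n. \<Sum>j=1..n. c i * c j * K (x i) (x j)) > 0))"

text \<open>A function of type \<open>real \<Rightarrow> real\<close> represents its restriction to \<open>[-1, 1]\<close>; its values
  elsewhere play no role.\<close>

definition isotropic_part_pd :: "(real \<Rightarrow> real) \<Rightarrow> bool" where
  "isotropic_part_pd f \<longleftrightarrow> continuous_on {-1..1} f \<and> positive_definite (isotropic_kernel f)"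

definition isotropic_part_spd :: "(real \<Rightarrow> real) \<Rightarrow> bool" where
  "isotropic_part_spd f \<longleftrightarrow>
     continuous_on {-1..1} f \<and> strictly_positive_definite (isotropic_kernel f)"

text \<open>The Jacobi polynomial \<open>P\<^sub>n\<^sup>(\<^sup>\<alpha>\<^sup>,\<^sup>\<beta>\<^sup>)\<close> in the standard normalization
  \<open>P\<^sub>n(1) = (n + \<alpha>) gchoose n\<close>, by the explicit form of Rodrigues' formula.\<close>

definition jacobi_P :: "real \<Rightarrow> real \<Rightarrow> nat \<Rightarrow> real \<Rightarrow> real" where
  "jacobi_P \<alpha> \<beta> n t =
     (\<Sum>s=0..n. ((real n + \<alpha>) gchoose (n - s)) * ((real n + \<beta>) gchoose s) *
               ((t - 1) / 2) ^ s * ((t + 1) / 2) ^ (n - s))"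

definition fourier_jacobi_rep :: "(real \<Rightarrow> real) \<Rightarrow> (nat \<Rightarrow> real) \<Rightarrow> bool" where
  "fourier_jacobi_rep f a \<longleftrightarrow>
     (\<forall>k. a k \<ge> 0) \<and>
     summable (\<lambda>k. a k * jacobi_P (-1/2) (-1/2) k 1) \<and>
     (\<forall>t\<in>{-1..1}. (\<lambda>k. a k * jacobi_P (-1/2) (-1/2) k t) sums f t)"

definition full_arith_progression :: "int set \<Rightarrow> bool" where
  "full_arith_progression A \<longleftrightarrow>
     (\<exists>n j :: nat. n \<ge> 2 \<and> A = {int n * l + int j | l :: int. True})"

end

theory Submission
  imports Defs "HOL-Computational_Algebra.Polynomial"
begin

text \<open>With \<open>p m = \<Sum>\<^sub>i c\<^sub>i exp (\<i> m \<theta>\<^sub>i)\<close>, the quadratic form of the product kernel is a combination with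
  nonnegative coefficients \<open>\<alpha>\<^sub>k \<beta>\<^sub>l\<close> of the numbers \<open>(\<bar>p (k + l)\<bar>\<^sup>2 + \<bar>p (k - l)\<bar>\<^sup>2) / 2\<close>, so strict positive
  definiteness means that no nonzero \<open>p\<close> vanishes on the set in the statement.  If that set misses
  \<open>n\<int> + j\<close>, the \<open>n\<close>-th roots of unity with \<open>c\<^sub>i = cos (j \<theta>\<^sub>i)\<close> give a \<open>p\<close> supported on the residues \<open>\<plusminus>j\<close>.
  Conversely, a nonzero \<open>p\<close> has no zero on some full arithmetic progression.  Instead of the
  Skolem-Mahler-Lech theorem one uses reduction modulo an ideal: if \<open>p r \<noteq> 0\<close>, the ring generated by
  the \<open>c\<^sub>i\<close> and \<open>exp (\<plusminus>\<i> \<theta>\<^sub>i)\<close> has a proper ideal of finite index modulo which \<open>p r\<close> is a unit; the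
  \<open>exp (\<i> \<theta>\<^sub>i)\<close> have finite order in the quotient, so \<open>p\<close> is periodic there and never zero on the class of
  \<open>r\<close>.\<close>

section \<open>Finite quotients of finitely generated rings\<close>

text \<open>Subrings are carrier sets in one ambient ring, so that a ring can grow by one generator
  at a time within the same type.\<close>

definition subring :: "'a::comm_ring_1 set \<Rightarrow> bool" where
  "subring A \<longleftrightarrow> 1 \<in> A \<and> (\<forall>x\<in>A. \<forall>y\<in>A. x - y \<in> A) \<and> (\<forall>x\<in>A. \<forall>y\<in>A. x * y \<in> A)"

definition ideal_in :: "'a::comm_ring_1 set \<Rightarrow> 'a set \<Rightarrow> bool" where
  "ideal_in I A \<longleftrightarrow> I \<subseteq> A \<and> 0 \<in> I \<and> (\<forall>x\<in>I. \<forall>y\<in>I. x + y \<in> I) \<and> (\<forall>a\<in>A. \<forall>x\<in>I. a * x \<in> I)"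

text \<open>Applied also to an ideal \<open>I\<close> of \<open>A\<close>, where it yields the ideal
  \<open>I[X]\<close> of \<open>A[X]\<close>.\<close>

definition polys_over :: "'a::comm_ring_1 set \<Rightarrow> 'a poly set" where
  "polys_over A = {p. \<forall>i. coeff p i \<in> A}"

definition adjoin :: "'a::comm_ring_1 set \<Rightarrow> 'a \<Rightarrow> 'a set" where
  "adjoin A y = (\<lambda>p. poly p y) ` polys_over A"

text \<open>The image of \<open>u\<close> is a unit in some nonzero finite quotient of
  \<open>A\<close>. The quotient is not formed: \<open>T\<close> contains a representative of every
  class, and \<open>v\<close> is an inverse of \<open>u\<close> modulo \<open>I\<close>.\<close>

definition finite_residue_unit :: "'a::comm_ring_1 set \<Rightarrow> 'a \<Rightarrow> bool" where
  "finite_residue_unit A u \<longleftrightarrow>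
     (\<exists>I T v. ideal_in I A \<and> 1 \<notin> I \<and> finite T \<and> T \<subseteq> A \<and> (\<forall>x\<in>A. \<exists>t\<in>T. x - t \<in> I) \<and>
       v \<in> A \<and> u * v - 1 \<in> I)"

section \<open>Closure properties of subrings and ideals\<close>

lemma subring_one: "subring A \<Longrightarrow> 1 \<in> A"
  and subring_diff: "subring A \<Longrightarrow> x \<in> A \<Longrightarrow> y \<in> A \<Longrightarrow> x - y \<in> A"
  and subring_mult: "subring A \<Longrightarrow> x \<in> A \<Longrightarrow> y \<in> A \<Longrightarrow> x * y \<in> A"
  by (auto simp: subring_def)

lemma subring_zero: "subring A \<Longrightarrow> 0 \<in> A"
  using subring_diff[of A 1 1] subring_one[of A] by simp

lemma subring_uminus: "subring A \<Longrightarrow> x \<in> A \<Longrightarrow> - x \<in> A"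
  using subring_diff[of A 0 x] subring_zero[of A] by simp

lemma subring_add: "subring A \<Longrightarrow> x \<in> A \<Longrightarrow> y \<in> A \<Longrightarrow> x + y \<in> A"
  using subring_diff[of A x "- y"] subring_uminus[of A y] by simp

lemma subring_power: "subring A \<Longrightarrow> x \<in> A \<Longrightarrow> x ^ n \<in> A"
  by (induction n) (auto simp: subring_one subring_mult)

lemma subring_sum: "subring A \<Longrightarrow> (\<And>i. i \<in> S \<Longrightarrow> f i \<in> A) \<Longrightarrow> sum f S \<in> A"
  by (induction S rule: infinite_finite_induct) (auto simp: subring_zero subring_add)

lemma subring_of_nat: "subring A \<Longrightarrow> of_nat n \<in> A"
  by (induction n) (auto simp: subring_zero subring_one subring_add)

lemmas subring_closed = subring_one subring_diff subring_mult subring_zero subring_uminus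
  subring_add subring_power subring_sum subring_of_nat

lemma subring_Ints: "subring \<int>"
  by (auto simp: subring_def)

lemma ideal_in_subset: "ideal_in I A \<Longrightarrow> x \<in> I \<Longrightarrow> x \<in> A"
  and ideal_in_zero: "ideal_in I A \<Longrightarrow> 0 \<in> I"
  and ideal_in_add: "ideal_in I A \<Longrightarrow> x \<in> I \<Longrightarrow> y \<in> I \<Longrightarrow> x + y \<in> I"
  and ideal_in_mult: "ideal_in I A \<Longrightarrow> a \<in> A \<Longrightarrow> x \<in> I \<Longrightarrow> a * x \<in> I"
  by (auto simp: ideal_in_def)

lemma ideal_in_uminus: "ideal_in I A \<Longrightarrow> subring A \<Longrightarrow> x \<in> I \<Longrightarrow> - x \<in> I"
  using ideal_in_mult[of I A "- 1" x] by (simp add: subring_closed)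

lemma ideal_in_diff: "ideal_in I A \<Longrightarrow> subring A \<Longrightarrow> x \<in> I \<Longrightarrow> y \<in> I \<Longrightarrow> x - y \<in> I"
  using ideal_in_add[of I A x "- y"] ideal_in_uminus[of I A y] by simp

lemma ideal_in_sum: "ideal_in I A \<Longrightarrow> (\<And>i. i \<in> S \<Longrightarrow> f i \<in> I) \<Longrightarrow> sum f S \<in> I"
  by (induction S rule: infinite_finite_induct) (auto simp: ideal_in_zero ideal_in_add)

text \<open>Use x = v (u x) - x (u v - 1).\<close>

lemma ideal_in_cancel_unit:
  assumes "subring A" "ideal_in I A" "v \<in> A" "u * v - 1 \<in> I" "x \<in> A" "u * x \<in> I"
  shows "x \<in> I"
proof -
  have "v * (u * x) - x * (u * v - 1) \<in> I"
    using assms by (metis ideal_in_diff ideal_in_mult)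
  then show ?thesis by (simp add: algebra_simps)
qed

section \<open>Polynomials over a subring, adjunction of an element and pseudo-division\<close>

lemma polys_over_coeff: "p \<in> polys_over A \<Longrightarrow> coeff p i \<in> A"
  by (simp add: polys_over_def)

lemma subring_polys_over:
  assumes A: "subring A"
  shows "subring (polys_over A)"
  unfolding subring_def[of "polys_over A"] unfolding polys_over_def
  using A by (auto simp: coeff_mult coeff_1 intro!: subring_closed)

lemma polys_over_monom: "subring A \<Longrightarrow> c \<in> A \<Longrightarrow> monom c n \<in> polys_over A"
  by (auto simp: polys_over_def subring_closed)

lemma polys_over_const: "subring A \<Longrightarrow> c \<in> A \<Longrightarrow> [:c:] \<in> polys_over A"
  using polys_over_monom[of A c 0] by (simp add: monom_0)

lemma polys_over_smult: "subring A \<Longrightarrow> c \<in> A \<Longrightarrow> p \<in> polys_over A \<Longrightarrow> smult c p \<in> polys_over A"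
  by (auto simp: polys_over_def subring_closed)

lemma poly_in_subring:
  assumes "subring A" "p \<in> polys_over A" "x \<in> A"
  shows "poly p x \<in> A"
  using assms by (auto simp: poly_altdef polys_over_coeff intro!: subring_closed)

lemma polys_over_ideal:
  assumes A: "subring A" and I: "ideal_in I A"
  shows "ideal_in (polys_over I) (polys_over A)"
proof -
  have "coeff (p * q) i \<in> I" if "p \<in> polys_over A" "q \<in> polys_over I" for p q i
    using that by (auto simp: coeff_mult polys_over_coeff intro!: ideal_in_sum[OF I] ideal_in_mult[OF I])
  then show ?thesis
    using I by (auto simp: ideal_in_def polys_over_def)
qed

lemma subring_adjoin:
  assumes A: "subring A"
  shows "subring (adjoin A y)"
proof -
  note P = subring_polys_over[OF A]
  have "poly 1 y \<in> adjoin A y"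
    unfolding adjoin_def using P by (intro imageI subring_one)
  moreover have "poly p y - poly q y \<in> adjoin A y" "poly p y * poly q y \<in> adjoin A y"
    if "p \<in> polys_over A" "q \<in> polys_over A" for p q
    unfolding adjoin_def poly_diff[symmetric] poly_mult[symmetric] using that P
    by (blast intro: subring_diff subring_mult)+
  ultimately show ?thesis by (auto simp: subring_def adjoin_def)
qed

lemma subset_adjoin: "subring A \<Longrightarrow> A \<subseteq> adjoin A y"
  unfolding adjoin_def by (fastforce dest: polys_over_const intro: image_eqI[of _ _ "[:x:]" for x])

lemma adjoin_self: "subring A \<Longrightarrow> y \<in> adjoin A y"
  unfolding adjoin_def using polys_over_monom[of A 1 1]
  by (intro image_eqI[of _ _ "monom 1 1"]) (auto simp: poly_monom subring_one)

text \<open>The leading coefficient of \<open>f\<close> need not be invertible in \<open>A\<close>,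
  so each division step first multiplies the dividend by it.\<close>

lemma pseudo_division_over_subring:
  fixes f g :: "'a::idom poly"
  assumes A: "subring A" and f: "f \<in> polys_over A" "f \<noteq> 0" and g: "g \<in> polys_over A"
  shows "\<exists>n q r. q \<in> polys_over A \<and> r \<in> polys_over A \<and>
    smult (lead_coeff f ^ n) g = q * f + r \<and> (r = 0 \<or> degree r < degree f)"
  using g
proof (induction "degree g" arbitrary: g rule: less_induct)
  case (less g)
  note P = subring_polys_over[OF A]
  let ?a = "lead_coeff f"
  show ?case
  proof (cases "g = 0 \<or> degree g < degree f")
    case True
    then show ?thesis using less.prems subring_zero[OF P]
      by (intro exI[of _ 0] exI[of _ g]) auto
  next
    case False
    define m where "m = monom (lead_coeff g) (degree g - degree f)"
    \<comment> \<open>The leading terms of \<open>smult ?a g\<close> and \<open>m * f\<close>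
      cancel.\<close>
    define h where "h = smult ?a g - m * f"
    have m: "m \<in> polys_over A"
      using A less.prems by (auto simp: m_def intro!: polys_over_monom polys_over_coeff)
    have h: "h \<in> polys_over A"
      unfolding h_def using A P f m less.prems
      by (intro subring_diff subring_mult polys_over_smult polys_over_coeff) auto
    have "m \<noteq> 0" using False by (auto simp: m_def)
    have m': "degree m = degree g - degree f" using False by (simp add: m_def degree_monom_eq)
    then have dm: "degree (m * f) = degree g"
      using False f \<open>m \<noteq> 0\<close> by (simp add: degree_mult_eq)
    have "lead_coeff (m * f) = ?a * lead_coeff g"
      unfolding lead_coeff_mult m' by (simp add: m_def)
    then have c: "coeff h (degree g) = 0" using dm by (simp add: h_def)
    have le: "degree h \<le> degree g"
      unfolding h_def using dm by (intro degree_diff_le) auto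
    obtain n q r where IH: "q \<in> polys_over A" "r \<in> polys_over A"
      "smult (?a ^ n) h = q * f + r" "r = 0 \<or> degree r < degree f"
    \<comment> \<open>If \<open>h = 0\<close>, its degree 0 may equal that of \<open>g\<close>, so
      the induction hypothesis need not apply.\<close>
    proof (cases "h = 0")
      case True
      then show ?thesis using that[of 0 0 0] subring_zero[OF P] by auto
    next
      case False
      then have "degree h < degree g" using c le
        by (metis le_neq_implies_less leading_coeff_0_iff)
      then show ?thesis using less.hyps h that by blast
    qed
    have "smult (?a ^ Suc n) g = smult (?a ^ n) (h + m * f)"
      by (simp add: h_def mult.commute)
    also have "\<dots> = (q + smult (?a ^ n) m) * f + r"
      using IH by (simp add: smult_add_right algebra_simps)
    finally show ?thesis
      using IH A P m f
      by (intro exI[of _ "Suc n"] exI[of _ "q + smult (?a ^ n) m"] exI[of _ r])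
        (auto intro!: subring_add polys_over_smult subring_power polys_over_coeff)
  qed
qed

text \<open>Reduce modulo \<open>\<bar>u\<bar> + 1\<close>.\<close>

lemma finite_residue_unit_Ints:
  fixes u :: "'a::{ring_char_0,idom}"
  assumes u: "u \<in> \<int>" "u \<noteq> 0"
  shows "finite_residue_unit \<int> u"
proof -
  from u obtain k where k: "u = of_int k" "k \<noteq> 0" by (auto elim: Ints_cases)
  define N where "N = \<bar>k\<bar> + 1"
  define I where "I = (\<lambda>i. of_int (N * i) :: 'a) ` UNIV"
  have N: "N \<ge> 2" using k by (auto simp: N_def)
  have "ideal_in I \<int>"
    unfolding ideal_in_def
  proof (intro conjI ballI)
    show "0 \<in> I" unfolding I_def by (intro image_eqI[of _ _ 0]) auto
    show "I \<subseteq> \<int>" by (auto simp: I_def)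
    show "x + y \<in> I" if "x \<in> I" "y \<in> I" for x y
      using that unfolding I_def by (auto simp flip: of_int_add distrib_left of_int_mult)
    show "x * y \<in> I" if "x \<in> \<int>" "y \<in> I" for x y
      using that unfolding I_def by (auto elim!: Ints_cases simp flip: of_int_mult simp: mult.left_commute)
  qed
  moreover have "1 \<notin> I"
  proof
    assume "1 \<in> I"
    then obtain i where "of_int (N * i) = (of_int 1 :: 'a)" by (auto simp: I_def)
    then have "N * i = 1" by (simp only: of_int_eq_iff)
    then show False using N by (auto simp: zmult_eq_1_iff)
  qed
  moreover have "\<forall>x\<in>\<int>. \<exists>t\<in>of_int ` {0..<N}. x - t \<in> I"
  proof
    fix x :: 'a assume "x \<in> \<int>"
    then obtain z where z: "x = of_int z" by (auto elim: Ints_cases)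
    have "x - of_int (z mod N) = of_int (N * (z div N))"
      unfolding z of_int_diff[symmetric] by (simp add: minus_mod_eq_mult_div)
    then show "\<exists>t\<in>of_int ` {0..<N}. x - t \<in> I"
      using N by (intro bexI[of _ "of_int (z mod N)"]) (auto simp: I_def)
  qed
  \<comment> \<open>The product of \<open>k\<close> and \<open>- sgn k\<close> is -|k|, which is
    congruent to 1 modulo |k| + 1.\<close>
  moreover have "u * of_int (- sgn k) - 1 \<in> I"
  proof -
    have "u * of_int (- sgn k) - 1 = of_int (N * (-1))"
      unfolding k N_def by (simp add: abs_sgn)
    then show ?thesis unfolding I_def by blast
  qed
  moreover have "of_int ` {0..<N} \<subseteq> (\<int> :: 'a set)" "of_int (- sgn k) \<in> (\<int> :: 'a set)"
    by auto
  ultimately show ?thesis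
    unfolding finite_residue_unit_def
    by (intro exI[of _ I] exI[of _ "of_int ` {0..<N}"] exI[of _ "of_int (- sgn k)"]) simp
qed

text \<open>Specialize \<open>y\<close> to an integer that is not a root of the polynomial representing \<open>u\<close>.\<close>

lemma finite_residue_unit_adjoin_transcendental:
  fixes y :: "'a::{ring_char_0,idom}"
  assumes A: "subring A" and IH: "\<And>u. u \<in> A \<Longrightarrow> u \<noteq> 0 \<Longrightarrow> finite_residue_unit A u"
    and tr: "\<And>f. f \<in> polys_over A \<Longrightarrow> poly f y = 0 \<Longrightarrow> f = 0"
    and u: "u \<in> adjoin A y" "u \<noteq> 0"
  shows "finite_residue_unit (adjoin A y) u"
proof -
  note P = subring_polys_over[OF A]
  obtain g where g: "g \<in> polys_over A" "u = poly g y" using u by (auto simp: adjoin_def)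
  with u have "g \<noteq> 0" by auto
  then have "finite {x. poly g x = 0}" by (rule poly_roots_finite)
  then have "finite (of_nat -` {x. poly g x = 0} :: nat set)"
    by (rule finite_vimageI) (simp add: inj_of_nat)
  then have "of_nat -` {x. poly g x = 0} \<noteq> (UNIV :: nat set)" by (metis infinite_UNIV_nat)
  then obtain m :: nat where m: "poly g (of_nat m) \<noteq> 0" by auto
  define s :: 'a where "s = of_nat m"
  have s: "s \<in> A" "poly g s \<noteq> 0" using A m by (auto simp: s_def subring_of_nat)
  have "finite_residue_unit A (poly g s)"
    using s A g by (intro IH poly_in_subring) auto
  then obtain I T v where I: "ideal_in I A" "1 \<notin> I" and T: "finite T" "T \<subseteq> A"
    "\<forall>x\<in>A. \<exists>t\<in>T. x - t \<in> I" and v: "v \<in> A" "poly g s * v - 1 \<in> I"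
    unfolding finite_residue_unit_def by blast
  \<comment> \<open>Since \<open>y\<close> is transcendental, y |-> \<open>s\<close> extends to a
    homomorphism from A[y] to \<open>A\<close>; \<open>J\<close> is the preimage of
    \<open>I\<close>.\<close>
  define J where "J = (\<lambda>h. poly h y) ` {h \<in> polys_over A. poly h s \<in> I}"
  have JI: "poly h y \<in> J" if "h \<in> polys_over A" "poly h s \<in> I" for h
    using that by (auto simp: J_def)
  have "ideal_in J (adjoin A y)"
    unfolding ideal_in_def
  proof (intro conjI ballI)
    show "J \<subseteq> adjoin A y" by (auto simp: J_def adjoin_def)
    show "0 \<in> J" using JI[of 0] P I by (auto simp: subring_closed ideal_in_zero)
    show "a + b \<in> J" if "a \<in> J" "b \<in> J" for a b
    proof -
      from that obtain p q where "p \<in> polys_over A" "q \<in> polys_over A" "poly p s \<in> I" "poly q s \<in> I"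
        "a = poly p y" "b = poly q y" by (auto simp: J_def)
      then show ?thesis using JI[of "p + q"] P I by (auto intro: subring_closed ideal_in_add)
    qed
    show "a * b \<in> J" if "a \<in> adjoin A y" "b \<in> J" for a b
    proof -
      from that obtain p q where "p \<in> polys_over A" "q \<in> polys_over A" "poly q s \<in> I"
        "a = poly p y" "b = poly q y" by (auto simp: J_def adjoin_def)
      moreover have "poly p s * poly q s \<in> I"
        using calculation A s by (intro ideal_in_mult[OF I(1)] poly_in_subring[OF A])
      ultimately show ?thesis using JI[of "p * q"] P by (simp add: subring_mult)
    qed
  qed
  moreover have "1 \<notin> J"
  proof
    assume "1 \<in> J"
    then obtain h where h: "h \<in> polys_over A" "poly h s \<in> I" "poly h y = 1" by (auto simp: J_def)
    then have "h - 1 = 0" using P by (intro tr) (auto intro: subring_closed)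
    with h I show False by auto
  qed
  moreover have "\<forall>x\<in>adjoin A y. \<exists>t\<in>T. x - t \<in> J"
  proof
    fix x assume "x \<in> adjoin A y"
    then obtain h where h: "h \<in> polys_over A" "x = poly h y" by (auto simp: adjoin_def)
    then obtain t where t: "t \<in> T" "poly h s - t \<in> I" using T s A by (meson poly_in_subring)
    then have "poly (h - [:t:]) y \<in> J"
      using T A P h by (intro JI) (auto intro!: subring_diff polys_over_const)
    then show "\<exists>t\<in>T. x - t \<in> J" using t h by auto
  qed
  moreover have "g * [:v:] - 1 \<in> polys_over A"
    using A v g by (intro subring_diff[OF P] subring_mult[OF P] subring_one[OF P] polys_over_const)
  then have "u * v - 1 \<in> J"
    using JI[of "g * [:v:] - 1"] v g by (simp add: mult.commute)
  ultimately show ?thesis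
    unfolding finite_residue_unit_def using T v subset_adjoin[OF A, of y]
    by (intro exI[of _ J] exI[of _ T] exI[of _ v]) auto
qed

text \<open>Among the polynomials over \<open>A\<close> whose value at \<open>y\<close> is a nonzero
  multiple of \<open>u\<close> in A[y], one of least degree is constant. Its value is then the
  required multiple.\<close>

lemma nonzero_multiple_in_base:
  fixes y :: "'a::idom"
  assumes A: "subring A" and f: "f \<in> polys_over A" "f \<noteq> 0" "poly f y = 0"
    and min: "\<And>h. h \<in> polys_over A \<Longrightarrow> poly h y = 0 \<Longrightarrow> h = 0 \<or> degree f \<le> degree h"
    and u: "u \<in> adjoin A y" "u \<noteq> 0"
  shows "\<exists>v\<in>adjoin A y. u * v \<in> A \<and> u * v \<noteq> 0"
proof -
  note P = subring_polys_over[OF A] and B = subring_adjoin[OF A, of y]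
  have pB: "poly p y \<in> adjoin A y" if "p \<in> polys_over A" for p
    using that by (simp add: adjoin_def)
  define G where "G = {g \<in> polys_over A. poly g y \<noteq> 0 \<and> (\<exists>v\<in>adjoin A y. poly g y = u * v)}"
  have "\<exists>g. g \<in> G" using u B by (force simp: G_def adjoin_def[of A y] intro: bexI[of _ 1] dest: subring_one)
  then obtain g where g: "g \<in> G" and gmin: "\<And>h. h \<in> G \<Longrightarrow> degree g \<le> degree h"
    using ex_has_least_nat[of "\<lambda>g. g \<in> G" _ degree] by blast
  from g obtain v where g': "g \<in> polys_over A" "poly g y \<noteq> 0" and v: "v \<in> adjoin A y" "poly g y = u * v"
    by (auto simp: G_def)
  have "g \<noteq> 0" using g' by auto
  \<comment> \<open>The pseudo-remainder of \<open>g\<close> by \<open>f\<close> takes at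
    \<open>y\<close> the value of \<open>g\<close> times a power of the leading coefficient of
    \<open>f\<close>, so it lies in \<open>G\<close> too.\<close>
  have lt: "degree g < degree f"
  proof -
    obtain n q r where r: "q \<in> polys_over A" "r \<in> polys_over A"
      "smult (lead_coeff f ^ n) g = q * f + r" "r = 0 \<or> degree r < degree f"
      using pseudo_division_over_subring[OF A f(1,2) g'(1)] by blast
    have "poly (smult (lead_coeff f ^ n) g) y = poly r y" unfolding r(3) using f by simp
    then have ry: "poly r y = lead_coeff f ^ n * poly g y" by simp
    then have "poly r y \<noteq> 0" using f g' by simp
    moreover have "poly r y = u * (lead_coeff f ^ n * v)" using ry v by simp
    moreover have "lead_coeff f ^ n * v \<in> adjoin A y"
      using v f B subset_adjoin[OF A, of y] by (intro subring_mult subring_power) (auto simp: polys_over_coeff)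
    ultimately have "r \<in> G" using r(2) unfolding G_def by blast
    then show ?thesis using gmin[of r] r(4) \<open>poly r y \<noteq> 0\<close> by auto
  qed
  obtain n q r where r: "q \<in> polys_over A" "r \<in> polys_over A"
    "smult (lead_coeff g ^ n) f = q * g + r" "r = 0 \<or> degree r < degree g"
    using pseudo_division_over_subring[OF A g'(1) \<open>g \<noteq> 0\<close> f(1)] by blast
  have "poly (smult (lead_coeff g ^ n) f) y = poly q y * poly g y + poly r y" unfolding r(3) by simp
  then have ry: "poly r y = - (poly q y * poly g y)" using f by (simp add: eq_neg_iff_add_eq_0 add.commute)
  \<comment> \<open>The value of \<open>r\<close> at \<open>y\<close> is a multiple of
    \<open>u\<close>. If \<open>degree g > 0\<close>, minimality of \<open>g\<close> makes this
    value 0, and minimality of \<open>f\<close> gives \<open>r = 0\<close>. Then \<open>q\<close> is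
    a nonzero polynomial vanishing at \<open>y\<close>, of degree smaller than that of
    \<open>f\<close>.\<close>
  have "degree g = 0"
  proof (rule ccontr)
    assume dg: "degree g \<noteq> 0"
    have "poly r y = 0"
    proof (rule ccontr)
      assume *: "poly r y \<noteq> 0"
      have "poly r y = u * (- poly q y * v)" using ry v by simp
      moreover have "- poly q y * v \<in> adjoin A y"
        using v B r pB by (intro subring_mult subring_uminus) auto
      ultimately have "r \<in> G" using r(2) * unfolding G_def by blast
      then show False using gmin[of r] r(4) * by auto
    qed
    then have "r = 0" using min[OF r(2)] r(4) lt by auto
    have "q \<noteq> 0" using r(3) \<open>r = 0\<close> \<open>g \<noteq> 0\<close> f by auto
    have "degree f = degree q + degree g"
      using arg_cong[OF r(3), of degree] \<open>r = 0\<close> \<open>g \<noteq> 0\<close> \<open>q \<noteq> 0\<close> by (simp add: degree_mult_eq)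
    moreover have "poly q y = 0" using ry \<open>poly r y = 0\<close> g' by auto
    ultimately show False using min[OF r(1)] \<open>q \<noteq> 0\<close> dg by auto
  qed
  then obtain c where "g = [:c:]" by (auto elim: degree_eq_zeroE)
  then have "u * v = c" "c \<in> A" "c \<noteq> 0" using v g' polys_over_coeff[OF g'(1), of 0] by auto
  then show ?thesis using v by auto
qed

text \<open>Let \<open>f\<close> be a polynomial over \<open>A\<close> of least degree vanishing at \<open>y\<close>, and choose the ideal \<open>I\<close> of \<open>A\<close>
  such that the leading coefficient \<open>a\<close> of \<open>f\<close> is a unit modulo \<open>I\<close>.  The ideal \<open>J\<close> generated by \<open>I\<close> in
  \<open>A[1/a][y]\<close> stays proper: otherwise \<open>a\<^sup>m (h - a\<^sup>n) = q f\<close> with \<open>h\<close> over \<open>I\<close>, and comparing coefficients from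
  the top puts \<open>q\<close>, hence a power of \<open>a\<close>, into \<open>I\<close>.\<close>

lemma finite_residue_unit_adjoin_algebraic:
  fixes y :: "'a::idom"
  assumes A: "subring A" and IH: "\<And>u. u \<in> A \<Longrightarrow> u \<noteq> 0 \<Longrightarrow> finite_residue_unit A u"
    and alg: "f\<^sub>0 \<in> polys_over A" "f\<^sub>0 \<noteq> 0" "poly f\<^sub>0 y = 0"
    and u: "u \<in> adjoin A y" "u \<noteq> 0"
  shows "finite_residue_unit (adjoin A y) u"
proof -
  note P = subring_polys_over[OF A] and B = subring_adjoin[OF A, of y]
  have pB: "poly p y \<in> adjoin A y" if "p \<in> polys_over A" for p
    using that by (simp add: adjoin_def)
  obtain f where f: "f \<in> polys_over A" "f \<noteq> 0" "poly f y = 0"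
    and fmin: "\<And>h. h \<in> polys_over A \<and> h \<noteq> 0 \<and> poly h y = 0 \<Longrightarrow> degree f \<le> degree h"
    using ex_has_least_nat[of "\<lambda>f. f \<in> polys_over A \<and> f \<noteq> 0 \<and> poly f y = 0" f\<^sub>0 degree] alg by blast
  have min: "h = 0 \<or> degree f \<le> degree h" if "h \<in> polys_over A" "poly h y = 0" for h
    using that fmin by blast
  define a d where "a = lead_coeff f" and "d = degree f"
  have a: "a \<in> A" "a \<noteq> 0" using f by (auto simp: a_def polys_over_coeff)
  obtain v where v: "v \<in> adjoin A y" "u * v \<in> A" "u * v \<noteq> 0"
    using nonzero_multiple_in_base[OF A f min u] by blast
  \<comment> \<open>Treating the product makes both \<open>a\<close> and \<open>u\<close> units: if
    \<open>w\<close> inverts it, then \<open>u * v * w\<close> inverts \<open>a\<close> and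
    \<open>a * v * w\<close> inverts \<open>u\<close>.\<close>
  have "finite_residue_unit A (a * (u * v))"
    using a v(3) subring_mult[OF A a(1) v(2)] by (intro IH) simp_all
  then obtain I T w where I: "ideal_in I A" "1 \<notin> I" and T: "finite T" "T \<subseteq> A"
    "\<forall>x\<in>A. \<exists>t\<in>T. x - t \<in> I" and w: "w \<in> A" "a * (u * v) * w - 1 \<in> I"
    unfolding finite_residue_unit_def by blast
  note PI = polys_over_ideal[OF A I(1)]
  define a' where "a' = u * v * w"
  have a': "a' \<in> A" "a * a' - 1 \<in> I" using subring_mult[OF A v(2) w(1)] w(2) by (simp_all add: a'_def mult_ac)
  have cancel: "x \<in> I" if "x \<in> A" "a * x \<in> I" for x
    using ideal_in_cancel_unit[OF A I(1) a' that] .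
  have cancel_pow: "x \<in> I" if "x \<in> A" "a ^ n * x \<in> I" for x n
    using that
  proof (induction n arbitrary: x)
    case (Suc n)
    have "a ^ n * (a * x) \<in> I" using Suc.prems by (simp add: mult_ac)
    then have "a * x \<in> I" using Suc.IH subring_mult[OF A a(1) Suc.prems(1)] by blast
    then show ?case by (rule cancel[OF Suc.prems(1)])
  qed simp
  \<comment> \<open>Clearing denominators avoids the localization: \<open>J\<close> is the
    contraction to A[y] of the ideal that \<open>I\<close> generates in A[1/a][y].\<close>
  define J where "J = {b \<in> adjoin A y. \<exists>n. \<exists>h\<in>polys_over I. a ^ n * b = poly h y}"
  have IP: "h \<in> polys_over A" if "h \<in> polys_over I" for h
    using that I by (auto simp: polys_over_def ideal_in_def)
  have JI: "poly h y \<in> J" if "h \<in> polys_over I" for h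
    using that pB[OF IP[OF that]] unfolding J_def by (auto intro!: exI[of _ 0])
  have IJ: "i \<in> J" if "i \<in> I" for i
    using JI[of "[:i:]"] that I by (auto simp: polys_over_def coeff_pCons ideal_in_def split: nat.splits)
  have J: "ideal_in J (adjoin A y)"
    unfolding ideal_in_def
  proof (intro conjI ballI)
    show "J \<subseteq> adjoin A y" by (auto simp: J_def)
    show "0 \<in> J" using IJ I by (simp add: ideal_in_zero)
    show "b + c \<in> J" if bc: "b \<in> J" "c \<in> J" for b c
    proof -
      from bc obtain n h m k where h: "h \<in> polys_over I" "k \<in> polys_over I"
        "a ^ n * b = poly h y" "a ^ m * c = poly k y" "b \<in> adjoin A y" "c \<in> adjoin A y"
        by (auto simp: J_def)
      have "smult (a ^ e) h \<in> polys_over I" if "h \<in> polys_over I" for e h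
        using that A I a by (auto simp: polys_over_def intro!: ideal_in_mult subring_power)
      then have "smult (a ^ m) h + smult (a ^ n) k \<in> polys_over I"
        using h by (intro ideal_in_add[OF PI])
      moreover have "a ^ (n + m) * (b + c) = a ^ m * (a ^ n * b) + a ^ n * (a ^ m * c)"
        by (simp add: power_add algebra_simps)
      then have "a ^ (n + m) * (b + c) = poly (smult (a ^ m) h + smult (a ^ n) k) y"
        using h by simp
      ultimately show ?thesis using h B unfolding J_def by (blast intro: subring_add)
    qed
    show "b * c \<in> J" if bc: "b \<in> adjoin A y" "c \<in> J" for b c
    proof -
      from bc obtain p n h where h: "p \<in> polys_over A" "b = poly p y" "h \<in> polys_over I"
        "a ^ n * c = poly h y" "c \<in> adjoin A y" by (auto simp: J_def adjoin_def)
      then have "p * h \<in> polys_over I" by (intro ideal_in_mult[OF PI])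
      moreover have "a ^ n * (b * c) = poly (p * h) y" using h by (simp add: mult_ac)
      ultimately show ?thesis using bc h B unfolding J_def by (blast intro: subring_mult)
    qed
  qed
  have "1 \<notin> J"
  proof
    assume "1 \<in> J"
    then obtain n h where h: "h \<in> polys_over I" "a ^ n = poly h y" by (auto simp: J_def)
    have g: "h - [:a ^ n:] \<in> polys_over A"
      by (intro subring_diff[OF P] IP h polys_over_const[OF A] subring_power[OF A] a)
    \<comment> \<open>As \<open>h - [:a ^ n:]\<close> vanishes at \<open>y\<close>, so does its
      pseudo-remainder by \<open>f\<close>, which is therefore zero by minimality.\<close>
    obtain m q r where r: "q \<in> polys_over A" "r \<in> polys_over A"
      "smult (a ^ m) (h - [:a ^ n:]) = q * f + r" "r = 0 \<or> degree r < degree f"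
      using pseudo_division_over_subring[OF A f(1,2) g, folded a_def] by blast
    have "poly r y = poly (smult (a ^ m) (h - [:a ^ n:]) - q * f) y" unfolding r(3) by simp
    also have "\<dots> = 0" using h f by simp
    finally have "r = 0" using min[OF r(2)] r(4) by auto
    then have qf: "smult (a ^ m) (h - [:a ^ n:]) = q * f" using r by simp
    \<comment> \<open>A nonzero constant has no root. Because \<open>d > 0\<close>, the constant
      \<open>a ^ n\<close> does not enter the coefficients of index \<open>i + d\<close> compared
      below.\<close>
    have "d > 0" using f unfolding d_def by (metis degree_eq_zeroE gr0I mult_zero_right poly_0 poly_pCons pCons_0_0 add.right_neutral)
    have hI: "a ^ m * coeff h k \<in> I" for k
      using h A a by (intro ideal_in_mult[OF I(1)]) (auto simp: polys_over_coeff subring_power)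
    have qI: "coeff q i \<in> I" for i
    proof (induction "degree q - i" arbitrary: i rule: less_induct)
      case less
      show ?case
      proof (cases "i > degree q")
        case True
        then show ?thesis using I by (simp add: coeff_eq_0 ideal_in_zero)
      next
        case False
        have "coeff (q * f) (i + d) = a ^ m * coeff h (i + d)"
          using \<open>d > 0\<close> unfolding qf[symmetric] by (simp add: coeff_pCons split: nat.split)
        then have *: "coeff (q * f) (i + d) \<in> I" using hI by simp
        have "coeff (q * f) (i + d) = (\<Sum>j\<le>i + d. coeff q j * coeff f (i + d - j))"
          by (rule coeff_mult)
        \<comment> \<open>The remaining terms with \<open>j < i\<close> vanish by the degree of
          \<open>f\<close>; those with \<open>j > i\<close> lie in \<open>I\<close> by descending
          induction.\<close>
        also have "\<dots> = coeff q i * coeff f d + (\<Sum>j\<in>{..i + d} - {i}. coeff q j * coeff f (i + d - j))"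
          by (subst sum.remove[of _ i]) auto
        finally have split: "a * coeff q i = coeff (q * f) (i + d) - (\<Sum>j\<in>{..i + d} - {i}. coeff q j * coeff f (i + d - j))"
          by (simp add: a_def d_def)
        have "coeff q j * coeff f (i + d - j) \<in> I" if "j \<in> {..i + d} - {i}" for j
        proof (cases "j < i")
          case True
          then have "coeff f (i + d - j) = 0" by (intro coeff_eq_0) (auto simp: d_def)
          then show ?thesis using I by (simp add: ideal_in_zero)
        next
          case False': False
          have "coeff q j \<in> I"
          proof (cases "j > degree q")
            case True
            then show ?thesis using I by (simp add: coeff_eq_0 ideal_in_zero)
          next
            case False
            then show ?thesis using False' that by (intro less) auto
          qed
          then show ?thesis using ideal_in_mult[OF I(1) polys_over_coeff[OF f(1)]] by (simp add: mult.commute)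
        qed
        then have "a * coeff q i \<in> I"
          unfolding split by (intro ideal_in_diff[OF I(1) A *] ideal_in_sum[OF I(1)])
        then show ?thesis by (rule cancel[OF polys_over_coeff[OF r(1)]])
      qed
    qed
    then have "f * q \<in> polys_over I" by (intro ideal_in_mult[OF PI f(1)]) (simp add: polys_over_def)
    \<comment> \<open>The constant term of \<open>q * f\<close> is
      \<open>a ^ m * (coeff h 0 - a ^ n)\<close>, which puts \<open>a ^ (m + n)\<close> into
      \<open>I\<close>; cancelling the unit \<open>a\<close> gives the contradiction 1 in
      \<open>I\<close>.\<close>
    then have "coeff (q * f) 0 \<in> I" by (simp add: polys_over_coeff mult.commute)
    then have "a ^ m * coeff h 0 - a ^ m * a ^ n \<in> I"
      unfolding qf[symmetric] by (simp add: algebra_simps)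
    then have "a ^ m * coeff h 0 - (a ^ m * coeff h 0 - a ^ m * a ^ n) \<in> I"
      by (rule ideal_in_diff[OF I(1) A hI])
    then have "a ^ (m + n) * 1 \<in> I" by (simp add: power_add)
    then show False using cancel_pow[of 1] I A by (auto simp: subring_one)
  qed
  \<comment> \<open>Modulo \<open>J\<close> the leading coefficient of \<open>f\<close> is a unit,
    so 1, y, ..., \<open>y ^ (d - 1)\<close> span the quotient, and coefficients from
    \<open>T\<close> suffice. Extensional functions keep the set of coefficient choices
    finite.\<close>
  define T' where "T' = (\<lambda>t. \<Sum>i<d. t i * y ^ i) ` ({..<d} \<rightarrow>\<^sub>E T)"
  have yB: "y ^ i \<in> adjoin A y" for i
    using adjoin_self[OF A] B by (intro subring_power)
  have red: "\<exists>r\<in>polys_over A. (\<forall>i\<ge>d. coeff r i = 0) \<and> poly g y - poly r y \<in> J" if "g \<in> polys_over A" for g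
  proof -
    have "\<exists>r\<in>polys_over A. (\<forall>i\<ge>d. coeff r i = 0) \<and> poly g y - poly r y \<in> J"
      if "g \<in> polys_over A" "\<forall>i\<ge>N. coeff g i = 0" for g N
      using that
    proof (induction N arbitrary: g)
      case 0
      then show ?case using J by (intro bexI[of _ g]) (auto simp: ideal_in_zero)
    next
      case (Suc N)
      show ?case
      proof (cases "N < d")
        case True
        then show ?thesis using Suc.prems J by (intro bexI[of _ g]) (auto simp: ideal_in_zero)
      next
        case False
        define c where "c = coeff g N"
        \<comment> \<open>Subtracting the multiple of \<open>f\<close> leaves
          \<open>c * (1 - a * a')\<close> as coefficient of index \<open>N\<close>. This lies in
          \<open>I\<close>, so the last monomial removes it at the cost of an element of
          \<open>J\<close>.\<close>
        define k where "k = g - monom (c * a') (N - d) * f + monom (c * (a * a' - 1)) N"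
        have c: "c \<in> A" using Suc.prems by (simp add: c_def polys_over_coeff)
        have cI: "c * (a * a' - 1) \<in> I" using c a' by (intro ideal_in_mult[OF I(1)])
        have "k \<in> polys_over A"
          unfolding k_def
          by (intro subring_add[OF P] subring_diff[OF P] subring_mult[OF P] polys_over_monom[OF A]
              subring_mult[OF A c a'(1)] ideal_in_subset[OF I(1) cI] Suc.prems f)
        moreover have "\<forall>i\<ge>N. coeff k i = 0"
        proof (intro allI impI)
          fix i assume i: "N \<le> i"
          show "coeff k i = 0"
          proof (cases "i = N")
            case True
            have "coeff f (N - (N - d)) = a" using False by (simp add: a_def d_def)
            then have "coeff k N = c - c * a' * a + c * (a * a' - 1)"
              by (simp add: k_def c_def coeff_monom_mult)
            then show ?thesis using True by (simp add: algebra_simps)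
          next
            case False': False
            then have "coeff f (i - (N - d)) = 0" using i False by (intro coeff_eq_0) (auto simp: d_def)
            then show ?thesis using i False' Suc.prems by (simp add: k_def coeff_monom_mult)
          qed
        qed
        ultimately obtain r where r: "r \<in> polys_over A" "\<forall>i\<ge>d. coeff r i = 0" "poly k y - poly r y \<in> J"
          using Suc.IH by blast
        have yN: "y ^ N * (c * (a * a' - 1)) \<in> J" by (rule ideal_in_mult[OF J yB IJ[OF cI]])
        have "(poly k y - poly r y) - y ^ N * (c * (a * a' - 1)) \<in> J"
          by (rule ideal_in_diff[OF J B r(3) yN])
        moreover have "(poly k y - poly r y) - y ^ N * (c * (a * a' - 1)) = poly g y - poly r y"
          using f by (simp add: k_def poly_monom algebra_simps)
        ultimately show ?thesis using r by auto
      qed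
    qed
    from this[OF that, of "Suc (degree g)"] show ?thesis by (auto simp: coeff_eq_0)
  qed
  have "\<forall>x\<in>adjoin A y. \<exists>t\<in>T'. x - t \<in> J"
  proof
    fix x assume "x \<in> adjoin A y"
    then obtain g where g: "g \<in> polys_over A" "x = poly g y" by (auto simp: adjoin_def)
    then obtain r where r: "r \<in> polys_over A" "\<forall>i\<ge>d. coeff r i = 0" "x - poly r y \<in> J"
      using red by blast
    have "\<forall>i. \<exists>t\<in>T. coeff r i - t \<in> I" using T r by (auto simp: polys_over_coeff)
    then obtain t where t: "\<And>i. t i \<in> T" "\<And>i. coeff r i - t i \<in> I" by metis
    define s where "s = (\<Sum>i<d. restrict t {..<d} i * y ^ i)"
    have "restrict t {..<d} \<in> {..<d} \<rightarrow>\<^sub>E T" using t by auto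
    then have "s \<in> T'" unfolding T'_def s_def by (rule imageI)
    have "poly r y = (\<Sum>i\<le>degree r. coeff r i * y ^ i)" by (rule poly_altdef)
    also have "\<dots> = (\<Sum>i<d. coeff r i * y ^ i)"
      using r(2) by (intro sum.mono_neutral_cong) (auto simp: coeff_eq_0 not_less intro: leI)
    finally have "poly r y - s = (\<Sum>i<d. y ^ i * (coeff r i - t i))"
      by (simp add: s_def sum_subtractf algebra_simps)
    also have "\<dots> \<in> J"
      by (intro ideal_in_sum[OF J] ideal_in_mult[OF J yB IJ[OF t(2)]])
    finally have "(x - poly r y) + (poly r y - s) \<in> J"
      using r by (intro ideal_in_add[OF J])
    then show "\<exists>t\<in>T'. x - t \<in> J" using \<open>s \<in> T'\<close> by auto
  qed
  moreover have "finite T'" unfolding T'_def using T by (intro finite_imageI finite_PiE) auto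
  moreover have "T' \<subseteq> adjoin A y"
    unfolding T'_def using T subset_adjoin[OF A, of y] yB
    by (auto intro!: subring_sum[OF B] subring_mult[OF B])
  moreover have "a * (v * w) \<in> adjoin A y"
    using a v w subset_adjoin[OF A, of y] by (intro subring_mult[OF B]) auto
  moreover have "u * (a * (v * w)) - 1 \<in> J"
    using IJ[OF w(2)] by (simp add: mult_ac)
  ultimately show ?thesis
    unfolding finite_residue_unit_def using J \<open>1 \<notin> J\<close>
    by (intro exI[of _ J] exI[of _ T'] exI[of _ "a * (v * w)"]) simp
qed

lemma finite_residue_unit_adjoin:
  fixes y :: "'a::{ring_char_0,idom}"
  assumes "subring A" "\<And>u. u \<in> A \<Longrightarrow> u \<noteq> 0 \<Longrightarrow> finite_residue_unit A u"
    and "u \<in> adjoin A y" "u \<noteq> 0"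
  shows "finite_residue_unit (adjoin A y) u"
proof (cases "\<exists>f\<in>polys_over A. f \<noteq> 0 \<and> poly f y = 0")
  case True
  then obtain f where f: "f \<in> polys_over A" "f \<noteq> 0" "poly f y = 0" by (elim bexE conjE)
  show ?thesis by (rule finite_residue_unit_adjoin_algebraic) (fact assms f)+
next
  case False
  show ?thesis
  proof (rule finite_residue_unit_adjoin_transcendental)
    show "f = 0" if "f \<in> polys_over A" "poly f y = 0" for f using that False by auto
  qed (fact assms)+
qed

text \<open>Start from the integers and adjoin the elements of \<open>Y\<close> one at a time, each
  being algebraic or transcendental over the ring reached so far. This stands in for the
  Nullstellensatz over the integers.\<close>

lemma finite_residue_unit_finitely_generated:
  fixes Y :: "'a::{ring_char_0,idom} set"
  assumes "finite Y"
  shows "\<exists>A. subring A \<and> Y \<subseteq> A \<and> (\<forall>u\<in>A. u \<noteq> 0 \<longrightarrow> finite_residue_unit A u)"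
  using assms
proof induction
  case empty
  show ?case using subring_Ints finite_residue_unit_Ints by (intro exI[of _ \<int>]) auto
next
  case (insert y Y)
  then obtain A where A: "subring A" "Y \<subseteq> A" "\<forall>u\<in>A. u \<noteq> 0 \<longrightarrow> finite_residue_unit A u"
    by (elim exE conjE)
  have "finite_residue_unit (adjoin A y) u" if "u \<in> adjoin A y" "u \<noteq> 0" for u
    using A(3) by (intro finite_residue_unit_adjoin[OF A(1) _ that]) simp
  moreover have "insert y Y \<subseteq> adjoin A y"
    using A(2) subset_adjoin[OF A(1), of y] adjoin_self[OF A(1), of y] by simp
  ultimately show ?case
    using subring_adjoin[OF A(1)] by (intro exI[of _ "adjoin A y"]) simp
qed

section \<open>Exponential sums\<close>

text \<open>By the pigeonhole principle two powers of \<open>x\<close> agree modulo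
  \<open>I\<close>; a power of the inverse \<open>x'\<close> cancels the smaller one.\<close>

lemma finite_order_mod_ideal:
  assumes A: "subring A" and I: "ideal_in I A"
    and T: "finite T" "\<forall>z\<in>A. \<exists>t\<in>T. z - t \<in> I"
    and x: "x \<in> A" "x' \<in> A" "x * x' = 1"
  shows "\<exists>n>0. x ^ n - 1 \<in> I"
proof -
  have "\<forall>k. \<exists>t\<in>T. x ^ k - t \<in> I" using A T x by (auto simp: subring_power)
  then obtain t where t: "\<And>k. t k \<in> T" "\<And>k. x ^ k - t k \<in> I" by metis
  have "\<not> inj_on t (UNIV :: nat set)"
    using finite_subset[of "range t" T] t(1) T(1) finite_imageD[of t UNIV] by auto
  then obtain i j :: nat where "i < j" "t i = t j"
    unfolding inj_on_def by (metis linorder_neqE_nat)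
  have "(x ^ j - t j) - (x ^ i - t i) \<in> I" by (intro ideal_in_diff[OF I A] t(2))
  then have *: "x' ^ i * (x ^ j - x ^ i) \<in> I"
    using A x I \<open>t i = t j\<close> by (auto intro!: ideal_in_mult subring_power)
  have "x ^ j = x ^ i * x ^ (j - i)" using \<open>i < j\<close> by (simp flip: power_add)
  then have "x' ^ i * (x ^ j - x ^ i) = (x * x') ^ i * (x ^ (j - i) - 1)"
    by (simp add: power_mult_distrib right_diff_distrib mult_ac)
  with * show ?thesis using x \<open>i < j\<close> by (intro exI[of _ "j - i"]) auto
qed

lemma exponential_sum_nonzero_on_progression:
  fixes c x :: "'i \<Rightarrow> 'a::field_char_0"
  assumes X: "finite X" "\<And>i. i \<in> X \<Longrightarrow> x i \<noteq> 0" and r: "(\<Sum>i\<in>X. c i * x i powi r) \<noteq> 0"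
  shows "\<exists>n>0. \<forall>l::int. (\<Sum>i\<in>X. c i * x i powi (r + int n * l)) \<noteq> 0"
proof -
  \<comment> \<open>The inverses are included so that negative powers stay in
    \<open>A\<close>.\<close>
  obtain A where A: "subring A" "c ` X \<union> x ` X \<union> (inverse \<circ> x) ` X \<subseteq> A"
    "\<And>u. u \<in> A \<Longrightarrow> u \<noteq> 0 \<Longrightarrow> finite_residue_unit A u"
    using finite_residue_unit_finitely_generated[of "c ` X \<union> x ` X \<union> (inverse \<circ> x) ` X"] X(1) by auto
  have powi: "x i powi k \<in> A" if "i \<in> X" for i k
    using that A by (auto simp: power_int_def intro!: subring_power[OF A(1)])
  define p where "p = (\<lambda>k. \<Sum>i\<in>X. c i * x i powi k)"
  have p: "p k \<in> A" for k
    unfolding p_def using A powi by (auto intro!: subring_sum[OF A(1)] subring_mult[OF A(1)])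
  obtain I T v where I: "ideal_in I A" "1 \<notin> I" and T: "finite T" "\<forall>x\<in>A. \<exists>t\<in>T. x - t \<in> I"
    and v: "v \<in> A" "p r * v - 1 \<in> I"
    using A(3)[of "p r"] p r unfolding finite_residue_unit_def p_def by blast
  have "\<forall>i\<in>X. \<exists>n>0. x i ^ n - 1 \<in> I"
  proof
    fix i assume "i \<in> X"
    then show "\<exists>n>0. x i ^ n - 1 \<in> I"
      using A(2) X by (intro finite_order_mod_ideal[OF A(1) I(1) T, of _ "inverse (x i)"]) auto
  qed
  then obtain m where m: "\<And>i. i \<in> X \<Longrightarrow> m i > 0" "\<And>i. i \<in> X \<Longrightarrow> x i ^ m i - 1 \<in> I"
    unfolding bchoice_iff by blast
  have pow: "z ^ k - 1 \<in> I" if "z \<in> A" "z - 1 \<in> I" for z k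
  proof (induction k)
    case (Suc k)
    have "z * (z ^ k - 1) + (z - 1) \<in> I"
      using Suc that by (intro ideal_in_add[OF I(1)] ideal_in_mult[OF I(1)])
    then show ?case by (simp add: algebra_simps)
  qed (simp add: ideal_in_zero[OF I(1)])
  \<comment> \<open>A common multiple of the orders of all \<open>x i\<close> modulo
    \<open>I\<close>, hence a period of \<open>p\<close> modulo \<open>I\<close>.\<close>
  define n where "n = prod m X"
  have n: "n > 0" using m by (auto simp: n_def intro!: prod_pos)
  have xn: "x i ^ n - 1 \<in> I" if i: "i \<in> X" for i
  proof -
    have "m i dvd n" unfolding n_def using X(1) i by (rule dvd_prodI)
    then obtain k where "n = m i * k" by (rule dvdE)
    then show ?thesis
      using pow[OF _ m(2)[OF i], of k] powi[OF i, of "int (m i)"] by (simp add: power_mult)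
  qed
  have xnl: "x i powi (int n * l) - 1 \<in> I" if "i \<in> X" for i l
  proof (cases "l \<ge> 0")
    case True
    then have "x i powi (int n * l) = (x i ^ n) ^ nat l"
      using X that by (simp add: power_int_mult power_int_def[of _ l])
    then show ?thesis using pow[OF _ xn[OF that], of "nat l"] powi[OF that, of "int n"] by simp
  next
    case False
    \<comment> \<open>For negative \<open>l\<close>, the power is inverse to one that is congruent
      to 1, so it is itself congruent to 1.\<close>
    then have e: "x i powi (int n * l) * (x i ^ n) ^ nat (- l) = 1"
      using X that by (simp add: power_int_mult power_int_def[of _ l] flip: power_mult_distrib)
    have "- (x i powi (int n * l)) * ((x i ^ n) ^ nat (- l) - 1) \<in> I"
      using pow[OF _ xn[OF that], of "nat (- l)"] powi[OF that, of "int n"] powi[OF that]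
      by (intro ideal_in_mult[OF I(1)] subring_uminus[OF A(1)]) simp_all
    then show ?thesis using e by (simp add: algebra_simps)
  qed
  have "p (r + int n * l) \<noteq> 0" for l
  proof
    assume 0: "p (r + int n * l) = 0"
    have "p (r + int n * l) - p r = (\<Sum>i\<in>X. c i * x i powi r * (x i powi (int n * l) - 1))"
      unfolding p_def sum_subtractf[symmetric] using X
      by (intro sum.cong) (auto simp: power_int_add algebra_simps)
    also have "\<dots> \<in> I"
      using A xnl powi by (intro ideal_in_sum[OF I(1)] ideal_in_mult[OF I(1)] subring_mult[OF A(1)]) auto
    \<comment> \<open>A zero on the progression would put \<open>p r\<close> into \<open>I\<close>,
      contradicting that it is a unit modulo the proper ideal \<open>I\<close>.\<close>
    finally have "v * (0 - p r) \<in> I" unfolding 0 by (intro ideal_in_mult[OF I(1) v(1)])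
    then have "- (p r * v - 1) - v * (0 - p r) \<in> I"
      by (rule ideal_in_diff[OF I(1) A(1) ideal_in_uminus[OF I(1) A(1) v(2)]])
    then show False using I by (simp add: mult.commute)
  qed
  then show ?thesis using n by (auto simp: p_def)
qed

text \<open>Test the vanishing exponential sum against \<open>\<Prod>\<^sub>j\<^sub>\<noteq>\<^sub>i (X - x\<^sub>j)\<close>.\<close>

lemma exponential_sum_not_zero:
  fixes c x :: "'i \<Rightarrow> 'a::idom"
  assumes X: "finite X" "inj_on x X" and i: "i \<in> X" "c i \<noteq> 0"
  shows "\<exists>r::nat. (\<Sum>j\<in>X. c j * x j ^ r) \<noteq> 0"
proof (rule ccontr)
  assume "\<not> ?thesis"
  then have 0: "(\<Sum>j\<in>X. c j * x j ^ r) = 0" for r by blast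
  have P: "(\<Sum>j\<in>X. c j * poly p (x j)) = 0" for p
  proof -
    have "(\<Sum>j\<in>X. c j * poly p (x j)) = (\<Sum>k\<le>degree p. coeff p k * (\<Sum>j\<in>X. c j * x j ^ k))"
      unfolding poly_altdef sum_distrib_left by (subst sum.swap) (simp add: mult_ac)
    then show ?thesis using 0 by simp
  qed
  define p where "p = (\<Prod>j\<in>X - {i}. [:- x j, 1:])"
  have "poly p (x j) = 0" if "j \<in> X - {i}" for j
    using that X by (auto simp: p_def poly_prod prod_zero_iff)
  then have "(\<Sum>j\<in>X - {i}. c j * poly p (x j)) = 0" by (intro sum.neutral) auto
  then have "c i * poly p (x i) = 0" using P[of p] X i by (simp add: sum.remove[of X i])
  moreover have "poly p (x i) \<noteq> 0"
    using X i by (auto simp: p_def poly_prod inj_on_def)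
  ultimately show False using i by simp
qed

section \<open>Cosine series and the quadratic form\<close>

text \<open>Each factor of the falling factorial is half an odd number, and products of consecutive
  odd numbers are quotients of factorials up to powers of 2.\<close>

lemma gbinomial_half:
  assumes "s \<le> n"
  shows "((real n - 1/2) gchoose s) =
    fact (2 * n) * fact (n - s) / (fact (2 * n - 2 * s) * fact n * fact s * 4 ^ s)"
  using assms
proof (induction s)
  case (Suc s)
  \<comment> \<open>Writing \<open>n = m + Suc s\<close> removes truncated subtraction from the
    factorials.\<close>
  define m where "m = n - Suc s"
  have n: "n = m + Suc s" using Suc.prems by (simp add: m_def)
  have "real (Suc s) * ((real n - 1/2) gchoose Suc s) = (real n - 1/2 - real s) * ((real n - 1/2) gchoose s)"
    using gbinomial_mult_1[of "real n - 1/2" s] by (simp add: algebra_simps)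
  also have "(real n - 1/2 - real s) = (2 * real m + 1) / 2" by (simp add: n field_simps)
  also have "((real n - 1/2) gchoose s) =
      fact (2 * n) / (fact n * fact s * 4 ^ s) * (fact (Suc m) / fact (2 * m + 2))"
    using Suc by (simp add: n)
  also have "(fact (Suc m) / fact (2 * m + 2) :: real) = fact m / (2 * (2 * real m + 1) * fact (2 * m))"
  proof -
    have "(fact (2 * m + 2) :: real) = (2 * real m + 2) * ((2 * real m + 1) * fact (2 * m))"
      by (simp add: algebra_simps)
    also have "\<dots> = (real m + 1) * (2 * (2 * real m + 1) * fact (2 * m))" by (simp add: algebra_simps)
    finally have "(fact (2 * m + 2) :: real) = (real m + 1) * (2 * (2 * real m + 1) * fact (2 * m))" .
    moreover have "(fact (Suc m) :: real) = (real m + 1) * fact m" by (simp add: add.commute)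
    moreover have "real m + 1 \<noteq> 0" by linarith
    ultimately show ?thesis by (metis mult_divide_mult_cancel_left)
  qed
  also have "(2 * real m + 1) / 2 * (fact (2 * n) / (fact n * fact s * 4 ^ s) * (fact m / (2 * (2 * real m + 1) * fact (2 * m))))
      = fact (2 * n) * fact m / (fact (2 * m) * (fact n * fact s * 4 ^ s) * 4)"
  proof -
    have "d / 2 * (u / x * (v / (2 * d * w))) = u * v / (w * x * 4)" if "d \<noteq> 0" for d u v w x :: real
      using that by (simp add: divide_simps)
    moreover have "2 * real m + 1 \<noteq> 0" by linarith
    ultimately show ?thesis by blast
  qed
  finally have "((real n - 1/2) gchoose Suc s) =
      fact (2 * n) * fact m / (fact (2 * m) * (fact n * fact s * 4 ^ s) * 4) / real (Suc s)"
    by (metis nonzero_mult_div_cancel_left of_nat_neq_0)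
  moreover have "2 * n - 2 * Suc s = 2 * m" by (simp add: n)
  ultimately show ?case by (simp add: m_def[symmetric] mult_ac)
qed simp

text \<open>The factor depending on \<open>s\<close> is a binomial coefficient of even index, as in
  the expansion of cos (2 n x); the other factor is the value of the Jacobi polynomial at 1.\<close>

lemma gbinomial_half_mult:
  assumes "s \<le> n"
  shows "((real n - 1/2) gchoose (n - s)) * ((real n - 1/2) gchoose s) =
    real ((2 * n) choose n) / 4 ^ n * real ((2 * n) choose (2 * s))"
proof -
  define m where "m = n - s"
  have n: "n = m + s" using assms by (simp add: m_def)
  have "((real n - 1/2) gchoose m) = fact (2 * n) * fact s / (fact (2 * s) * fact n * fact m * 4 ^ m)"
    using gbinomial_half[of m n] by (simp add: n)
  moreover have "((real n - 1/2) gchoose s) = fact (2 * n) * fact m / (fact (2 * m) * fact n * fact s * 4 ^ s)"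
    using gbinomial_half[of s n] by (simp add: n)
  moreover have "real ((2 * n) choose n) = fact (2 * n) / (fact n * fact n)"
    by (subst binomial_fact) auto
  moreover have "real ((2 * n) choose (2 * s)) = fact (2 * n) / (fact (2 * s) * fact (2 * m))"
    by (subst binomial_fact) (auto simp: n)
  moreover have "(4::real) ^ n = 4 ^ m * 4 ^ s" by (simp add: n power_add)
  ultimately show ?thesis by (simp add: m_def[symmetric])
qed

lemma sum_atMost_double:
  fixes f :: "nat \<Rightarrow> 'a::comm_monoid_add"
  assumes "\<And>s. f (Suc (2 * s)) = 0"
  shows "sum f {..2 * n} = (\<Sum>s\<le>n. f (2 * s))"
  by (induction n) (simp_all add: assms)

text \<open>De Moivre's formula and the binomial theorem: odd powers of \<i> sin x have real part
  0.\<close>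

lemma cos_multiple_double:
  "cos (real (2 * n) * x) = (\<Sum>s\<le>n. real ((2 * n) choose (2 * s)) * (- (sin x)\<^sup>2) ^ s * ((cos x)\<^sup>2) ^ (n - s))"
proof -
  have "cos (real (2 * n) * x) = Re (cis x ^ (2 * n))" by (simp add: Complex.DeMoivre)
  also have "cis x = \<i> * complex_of_real (sin x) + complex_of_real (cos x)" by (simp add: complex_eq_iff)
  also have "Re (\<dots> ^ (2 * n)) = (\<Sum>k\<le>2 * n. Re (of_nat ((2 * n) choose k) * (\<i> * sin x) ^ k * (cos x) ^ (2 * n - k)))"
    by (simp add: binomial_ring)
  also have "\<dots> = (\<Sum>s\<le>n. Re (of_nat ((2 * n) choose (2 * s)) * (\<i> * sin x) ^ (2 * s) * (cos x) ^ (2 * n - 2 * s)))"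
    by (rule sum_atMost_double) (simp add: power_mult_distrib power_mult)
  also have "\<dots> = (\<Sum>s\<le>n. real ((2 * n) choose (2 * s)) * (- (sin x)\<^sup>2) ^ s * ((cos x)\<^sup>2) ^ (n - s))"
  proof (rule sum.cong[OF refl])
    fix s
    have "(\<i> * complex_of_real (sin x)) ^ (2 * s) = of_real ((- (sin x)\<^sup>2) ^ s)"
      by (simp add: power_mult power_mult_distrib)
    moreover have "(complex_of_real (cos x)) ^ (2 * n - 2 * s) = of_real (((cos x)\<^sup>2) ^ (n - s))"
      by (simp flip: power_mult add: diff_mult_distrib2)
    ultimately have "of_nat ((2 * n) choose (2 * s)) * (\<i> * sin x) ^ (2 * s) * (cos x) ^ (2 * n - 2 * s)
        = complex_of_real (real ((2 * n) choose (2 * s)) * (- (sin x)\<^sup>2) ^ s * ((cos x)\<^sup>2) ^ (n - s))"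
      by (simp only: of_real_mult of_real_of_nat_eq of_real_power)
    then show "Re (of_nat ((2 * n) choose (2 * s)) * (\<i> * sin x) ^ (2 * s) * (cos x) ^ (2 * n - 2 * s))
        = real ((2 * n) choose (2 * s)) * (- (sin x)\<^sup>2) ^ s * ((cos x)\<^sup>2) ^ (n - s)"
      by (simp only: Re_complex_of_real)
  qed
  finally show ?thesis .
qed

text \<open>At half angles, (cos x - 1) / 2 and (cos x + 1) / 2 become minus a squared sine and a
  squared cosine, so the defining sum is the expansion of cos (2 n (x / 2)).\<close>

lemma jacobi_P_cos:
  "jacobi_P (-1/2) (-1/2) n (cos x) = real ((2 * n) choose n) / 4 ^ n * cos (real n * x)"
proof -
  have h: "(cos x - 1) / 2 = - (sin (x / 2))\<^sup>2" "(cos x + 1) / 2 = (cos (x / 2))\<^sup>2"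
    using cos_double_sin[of "x / 2"] cos_double_cos[of "x / 2"] by simp_all
  have "jacobi_P (-1/2) (-1/2) n (cos x) = (\<Sum>s\<le>n. real ((2 * n) choose n) / 4 ^ n *
      (real ((2 * n) choose (2 * s)) * (- (sin (x / 2))\<^sup>2) ^ s * ((cos (x / 2))\<^sup>2) ^ (n - s)))"
    unfolding jacobi_P_def h atMost_atLeast0
  proof (rule sum.cong[OF refl])
    fix s assume "s \<in> {0..n}"
    then show "((real n + - 1 / 2) gchoose (n - s)) * ((real n + - 1 / 2) gchoose s) *
         (- (sin (x / 2))\<^sup>2) ^ s * ((cos (x / 2))\<^sup>2) ^ (n - s) = real ((2 * n) choose n) / 4 ^ n *
      (real ((2 * n) choose (2 * s)) * (- (sin (x / 2))\<^sup>2) ^ s * ((cos (x / 2))\<^sup>2) ^ (n - s))"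
      using gbinomial_half_mult[of s n] by simp
  qed
  also have "\<dots> = real ((2 * n) choose n) / 4 ^ n * cos (real (2 * n) * (x / 2))"
    unfolding cos_multiple_double sum_distrib_left ..
  finally show ?thesis by simp
qed

text \<open>The criterion depends only on which coefficients are positive, so the positive
  normalizing factors can be absorbed.\<close>

lemma fourier_jacobi_rep_cosine_series:
  assumes "fourier_jacobi_rep f a"
  obtains \<alpha> where "\<And>k. \<alpha> k \<ge> 0" "\<And>k. \<alpha> k > 0 \<longleftrightarrow> a k > 0"
    "\<And>x. (\<lambda>k. \<alpha> k * cos (real k * x)) sums f (cos x)"
proof
  let ?\<alpha> = "\<lambda>k. a k * (real ((2 * k) choose k) / 4 ^ k)"
  have pos: "real ((2 * k) choose k) / 4 ^ k > 0" for k by simp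
  show "?\<alpha> k \<ge> 0" for k using assms pos[of k] by (simp add: fourier_jacobi_rep_def)
  show "?\<alpha> k > 0 \<longleftrightarrow> a k > 0" for k using pos[of k] by (metis mult_pos_pos zero_less_mult_pos2)
  show "(\<lambda>k. ?\<alpha> k * cos (real k * x)) sums f (cos x)" for x
  proof -
    have "(\<lambda>k. a k * jacobi_P (-1/2) (-1/2) k (cos x)) sums f (cos x)"
      using assms unfolding fourier_jacobi_rep_def by force
    then show ?thesis by (simp only: jacobi_P_cos mult.assoc)
  qed
qed

section \<open>Quadratic forms of products of cosine series\<close>

text \<open>The Fourier transform of the discrete measure with weights \<open>c i\<close> at the
  angles \<open>\<theta> i\<close>. The exponent is an integer because differences of frequencies
  occur.\<close>

definition trig_sum :: "nat \<Rightarrow> (nat \<Rightarrow> real) \<Rightarrow> (nat \<Rightarrow> real) \<Rightarrow> int \<Rightarrow> complex" where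
  "trig_sum n c \<theta> m = (\<Sum>i=1..n. of_real (c i) * cis (\<theta> i) powi m)"

lemma trig_sum_uminus: "trig_sum n c \<theta> (- m) = cnj (trig_sum n c \<theta> m)"
  by (simp add: trig_sum_def cis_power_int cis_cnj)

lemma cosine_form_eq_norm_trig_sum:
  "(\<Sum>i=1..n. \<Sum>j=1..n. c i * c j * cos (of_int m * (\<theta> i - \<theta> j))) = (cmod (trig_sum n c \<theta> m))\<^sup>2"
proof -
  have "(cmod (trig_sum n c \<theta> m))\<^sup>2 = Re (trig_sum n c \<theta> m * cnj (trig_sum n c \<theta> m))"
    by (metis Re_complex_of_real complex_norm_square)
  also have "\<dots> = (\<Sum>i=1..n. \<Sum>j=1..n. c i * c j * cos (of_int m * (\<theta> i - \<theta> j)))"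
    unfolding trig_sum_def cnj_sum sum_product Re_sum
    by (intro sum.cong refl) (simp add: cis_power_int cos_diff right_diff_distrib algebra_simps)
  finally show ?thesis ..
qed

text \<open>The product-to-sum formula is the source of the frequencies k + l and k - l in the
  criterion.\<close>

lemma cosine_product_form:
  "(\<Sum>i=1..n. \<Sum>j=1..n. c i * c j * (cos (real k * (\<theta> i - \<theta> j)) * cos (real l * (\<theta> i - \<theta> j)))) =
   ((cmod (trig_sum n c \<theta> (int k + int l)))\<^sup>2 + (cmod (trig_sum n c \<theta> (int k - int l)))\<^sup>2) / 2"
  unfolding cosine_form_eq_norm_trig_sum[symmetric] cos_times_cos
  by (simp add: sum.distrib[symmetric] sum_divide_distrib distrib_left add_divide_distrib algebra_simps)

text \<open>The series are expanded one after the other, so no double series is rearranged. All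
  terms are nonnegative, hence a sum is positive exactly if some term is.\<close>

lemma product_quadratic_form_pos_iff:
  fixes n :: nat and c \<theta> :: "nat \<Rightarrow> real"
  assumes \<alpha>: "\<And>k. \<alpha> k \<ge> 0" "\<And>x. (\<lambda>k. \<alpha> k * cos (real k * x)) sums f (cos x)"
    and \<beta>: "\<And>k. \<beta> k \<ge> 0" "\<And>x. (\<lambda>k. \<beta> k * cos (real k * x)) sums g (cos x)"
  defines "Q \<equiv> (\<Sum>i=1..n. \<Sum>j=1..n. c i * c j * (f (cos (\<theta> i - \<theta> j)) * g (cos (\<theta> i - \<theta> j))))"
  shows "Q \<ge> 0" and "Q > 0 \<longleftrightarrow> (\<exists>k l. \<alpha> k > 0 \<and> \<beta> l > 0 \<and>
    (trig_sum n c \<theta> (int k + int l) \<noteq> 0 \<or> trig_sum n c \<theta> (int k - int l) \<noteq> 0))"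
proof -
  define q where "q k l = ((cmod (trig_sum n c \<theta> (int k + int l)))\<^sup>2 +
    (cmod (trig_sum n c \<theta> (int k - int l)))\<^sup>2) / 2" for k l
  \<comment> \<open>The form in which only \<open>f\<close> has been replaced by its cosine of
    frequency \<open>k\<close>.\<close>
  define R where "R k = (\<Sum>i=1..n. \<Sum>j=1..n. c i * c j *
    (cos (real k * (\<theta> i - \<theta> j)) * g (cos (\<theta> i - \<theta> j))))" for k
  have q: "q k l \<ge> 0" "q k l > 0 \<longleftrightarrow>
      trig_sum n c \<theta> (int k + int l) \<noteq> 0 \<or> trig_sum n c \<theta> (int k - int l) \<noteq> 0" for k l
    by (auto simp: q_def add_pos_nonneg add_nonneg_pos)
  have "(\<lambda>l. \<beta> l * q k l) sums R k" for k
  proof -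
    have "(\<lambda>l. \<Sum>i=1..n. \<Sum>j=1..n. c i * c j * (cos (real k * (\<theta> i - \<theta> j)) *
        (\<beta> l * cos (real l * (\<theta> i - \<theta> j))))) sums R k"
      unfolding R_def by (intro sums_sum sums_mult \<beta>)
    then show ?thesis
      unfolding q_def cosine_product_form[symmetric] by (simp add: sum_distrib_left mult_ac)
  qed
  then have R: "R k = (\<Sum>l. \<beta> l * q k l)" "summable (\<lambda>l. \<beta> l * q k l)" for k
    by (simp_all add: sums_iff)
  have pos: "u * v > 0 \<longleftrightarrow> u > 0 \<and> v > 0" if "u \<ge> 0" "v \<ge> 0" for u v :: real
    using that by (auto simp: zero_less_mult_iff)
  have R0: "R k \<ge> 0" for k
    unfolding R(1) by (intro suminf_nonneg R(2) mult_nonneg_nonneg \<beta>(1) q(1))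
  have "R k > 0 \<longleftrightarrow> (\<exists>l. \<beta> l * q k l > 0)" for k
    unfolding R(1) by (intro suminf_pos_iff R(2) mult_nonneg_nonneg \<beta>(1) q(1))
  then have Rpos: "R k > 0 \<longleftrightarrow> (\<exists>l. \<beta> l > 0 \<and> q k l > 0)" for k
    by (simp only: pos[OF \<beta>(1) q(1)])
  have "(\<lambda>k. \<alpha> k * R k) sums Q"
  proof -
    have "(\<lambda>k. \<Sum>i=1..n. \<Sum>j=1..n. c i * c j * (\<alpha> k * cos (real k * (\<theta> i - \<theta> j)) *
        g (cos (\<theta> i - \<theta> j)))) sums Q"
      unfolding Q_def by (intro sums_sum sums_mult sums_mult2 \<alpha>)
    then show ?thesis
      unfolding R_def by (simp add: sum_distrib_left mult_ac)
  qed
  then have Q: "Q = (\<Sum>k. \<alpha> k * R k)" "summable (\<lambda>k. \<alpha> k * R k)"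
    by (simp_all add: sums_iff)
  show "Q \<ge> 0" unfolding Q(1) by (intro suminf_nonneg Q(2) mult_nonneg_nonneg \<alpha>(1) R0)
  have "Q > 0 \<longleftrightarrow> (\<exists>k. \<alpha> k * R k > 0)"
    unfolding Q(1) by (intro suminf_pos_iff Q(2) mult_nonneg_nonneg \<alpha>(1) R0)
  then have "Q > 0 \<longleftrightarrow> (\<exists>k. \<alpha> k > 0 \<and> R k > 0)"
    by (simp only: pos[OF \<alpha>(1) R0])
  then show "Q > 0 \<longleftrightarrow> (\<exists>k l. \<alpha> k > 0 \<and> \<beta> l > 0 \<and>
    (trig_sum n c \<theta> (int k + int l) \<noteq> 0 \<or> trig_sum n c \<theta> (int k - int l) \<noteq> 0))"
    unfolding Rpos q(2) by blast
qed

section \<open>Points on the circle\<close>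

definition circle_point :: "real \<Rightarrow> real ^ 2" where
  "circle_point t = vector [cos t, sin t]"

lemma inner_circle_point: "circle_point s \<bullet> circle_point t = cos (s - t)"
  by (simp add: circle_point_def inner_vec_def sum_2 cos_diff)

lemma circle_point_in_unit_circle: "circle_point t \<in> unit_circle"
  by (simp add: norm_eq_sqrt_inner inner_circle_point)

lemma unit_circle_angle:
  assumes "x \<in> unit_circle"
  shows "\<exists>t. x = circle_point t"
proof -
  have "x \<bullet> x = 1" using assms by (simp add: norm_eq_1)
  then have "(x $ 1)\<^sup>2 + (x $ 2)\<^sup>2 = 1" by (simp add: inner_vec_def sum_2 power2_eq_square)
  then obtain t where "x $ 1 = cos t" "x $ 2 = sin t" using sincos_total_2pi by blast
  then show ?thesis by (auto simp: circle_point_def vec_eq_iff forall_2)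
qed

lemma circle_point_eq_iff: "circle_point s = circle_point t \<longleftrightarrow> cis s = cis t"
  by (simp add: circle_point_def vec_eq_iff forall_2 complex_eq_iff)

lemma isotropic_kernel_circle_point:
  "isotropic_kernel f (circle_point s) (circle_point t) = f (cos (s - t))"
  by (simp add: isotropic_kernel_def geodesic_dist_def inner_circle_point cos_arccos_abs)

text \<open>Points are replaced by angles. Positive definiteness follows from \<open>nonneg\<close>,
  so only strictness remains; the case of no points is excluded by the nonzero weight.\<close>

lemma isotropic_part_spd_angles:
  assumes cont: "continuous_on {-1..1} h"
    and nonneg: "\<And>(n::nat) c \<theta>. (\<Sum>i=1..n. \<Sum>j=1..n. c i * c j * h (cos (\<theta> i - \<theta> j))) \<ge> 0"
  shows "isotropic_part_spd h \<longleftrightarrow>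
    (\<forall>(n::nat) c \<theta>. inj_on (cis \<circ> \<theta>) {1..n} \<longrightarrow> (\<exists>i\<in>{1..n}. c i \<noteq> 0) \<longrightarrow>
      (\<Sum>i=1..n. \<Sum>j=1..n. c i * c j * h (cos (\<theta> i - \<theta> j))) > 0)" (is "_ \<longleftrightarrow> ?R")
proof -
  have angles: "\<exists>\<theta>. (\<forall>i\<in>{1..n}. x i = circle_point (\<theta> i))"
    if "x ` {1..n} \<subseteq> unit_circle" for x and n :: nat
  proof (intro bchoice ballI)
    fix i assume "i \<in> {1..n}"
    then have "x i \<in> unit_circle" by (intro subsetD[OF that] imageI)
    then show "\<exists>t. x i = circle_point t" by (rule unit_circle_angle)
  qed
  have form: "(\<Sum>i=1..n. \<Sum>j=1..n. c i * c j * isotropic_kernel h (x i) (x j)) =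
      (\<Sum>i=1..n. \<Sum>j=1..n. c i * c j * h (cos (\<theta> i - \<theta> j)))"
    if "\<forall>i\<in>{1..n}. x i = circle_point (\<theta> i)" for x c \<theta> and n :: nat
    using that by (intro sum.cong refl) (simp add: isotropic_kernel_circle_point)
  have pd: "positive_definite (isotropic_kernel h)"
    unfolding positive_definite_def
  proof (intro allI impI)
    fix n :: nat and x :: "nat \<Rightarrow> real ^ 2" and c :: "nat \<Rightarrow> real"
    assume "x ` {1..n} \<subseteq> unit_circle"
    then obtain \<theta> where \<theta>: "\<forall>i\<in>{1..n}. x i = circle_point (\<theta> i)" using angles by blast
    show "(\<Sum>i=1..n. \<Sum>j=1..n. c i * c j * isotropic_kernel h (x i) (x j)) \<ge> 0"
      unfolding form[OF \<theta>] by (rule nonneg)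
  qed
  have spd: "(\<forall>n::nat. n \<ge> 1 \<longrightarrow> (\<forall>x c. inj_on x {1..n} \<longrightarrow> x ` {1..n} \<subseteq> unit_circle \<longrightarrow>
      (\<exists>i\<in>{1..n}. c i \<noteq> 0) \<longrightarrow>
      (\<Sum>i=1..n. \<Sum>j=1..n. c i * c j * isotropic_kernel h (x i) (x j)) > 0)) \<longleftrightarrow> ?R" (is "?L \<longleftrightarrow> _")
  proof
    assume L: ?L
    show ?R
    proof (intro allI impI)
      fix n :: nat and c \<theta> :: "nat \<Rightarrow> real"
      assume inj: "inj_on (cis \<circ> \<theta>) {1..n}" and c: "\<exists>i\<in>{1..n}. c i \<noteq> 0"
      from c have "n \<ge> 1" by auto
      have inj': "inj_on (\<lambda>i. circle_point (\<theta> i)) {1..n}"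
        using inj unfolding inj_on_def circle_point_eq_iff comp_def .
      have "(\<lambda>i. circle_point (\<theta> i)) ` {1..n} \<subseteq> unit_circle"
        using circle_point_in_unit_circle by blast
      from L[rule_format, of n "\<lambda>i. circle_point (\<theta> i)" c, OF \<open>n \<ge> 1\<close> inj' this c]
      show "(\<Sum>i=1..n. \<Sum>j=1..n. c i * c j * h (cos (\<theta> i - \<theta> j))) > 0"
        by (simp only: isotropic_kernel_circle_point)
    qed
  next
    assume R: ?R
    show ?L
    proof (intro allI impI)
      fix n :: nat and x :: "nat \<Rightarrow> real ^ 2" and c :: "nat \<Rightarrow> real"
      assume inj: "inj_on x {1..n}" and x: "x ` {1..n} \<subseteq> unit_circle" and c: "\<exists>i\<in>{1..n}. c i \<noteq> 0"
      obtain \<theta> where \<theta>: "\<forall>i\<in>{1..n}. x i = circle_point (\<theta> i)" using angles[OF x] by blast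
      have "inj_on (\<lambda>i. circle_point (\<theta> i)) {1..n}"
        using inj \<theta> by (metis (no_types, lifting) inj_on_cong)
      then have "inj_on (cis \<circ> \<theta>) {1..n}"
        unfolding inj_on_def circle_point_eq_iff comp_def .
      then show "(\<Sum>i=1..n. \<Sum>j=1..n. c i * c j * isotropic_kernel h (x i) (x j)) > 0"
        unfolding form[OF \<theta>] using c by (rule R[rule_format])
    qed
  qed
  show ?thesis
    unfolding isotropic_part_spd_def strictly_positive_definite_def spd by (simp only: cont pd simp_thms)
qed

section \<open>Arithmetic progressions and the two directions of the criterion\<close>

text \<open>A nonzero value at a natural number \<open>r\<close> spreads to a whole progression, and
  \<open>r\<close> serves as the natural offset of that progression.\<close>

lemma trig_sum_nonzero_on_progression:
  assumes "inj_on (cis \<circ> \<theta>) {1..n}" and "i \<in> {1..n}" "c i \<noteq> 0"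
  shows "\<exists>A. full_arith_progression A \<and> (\<forall>m\<in>A. trig_sum n c \<theta> m \<noteq> 0)"
proof -
  obtain r :: nat where "(\<Sum>j=1..n. complex_of_real (c j) * (cis \<circ> \<theta>) j ^ r) \<noteq> 0"
    using exponential_sum_not_zero[of "{1..n}" "cis \<circ> \<theta>" i "\<lambda>j. complex_of_real (c j)"] assms by auto
  then have "(\<Sum>j=1..n. complex_of_real (c j) * cis (\<theta> j) powi int r) \<noteq> 0" by simp
  then obtain N where N: "N > 0" "\<And>l. trig_sum n c \<theta> (int r + int N * l) \<noteq> 0"
    unfolding trig_sum_def
    using exponential_sum_nonzero_on_progression[of "{1..n}" "\<lambda>j. cis (\<theta> j)" "\<lambda>j. complex_of_real (c j)" "int r"]
    by auto
  \<comment> \<open>The period is doubled because \<open>N\<close> may be 1, whereas a full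
    progression needs modulus at least 2.\<close>
  have "trig_sum n c \<theta> (int (2 * N) * l + int r) \<noteq> 0" for l
    using N(2)[of "2 * l"] by (simp add: algebra_simps)
  moreover have "full_arith_progression {int (2 * N) * l + int r | l. True}"
    unfolding full_arith_progression_def using N(1) by (intro exI[of _ "2 * N"] exI[of _ r]) simp
  ultimately show ?thesis by (intro exI[of _ "{int (2 * N) * l + int r | l. True}"]) auto
qed

lemma cis_root_of_unity_eq_1:
  assumes "n > 0" "cis (2 * pi * of_int k / real n) = 1"
  shows "int n dvd k"
proof -
  have "cos (2 * pi * of_int k / real n) = 1" using assms(2) by (simp add: complex_eq_iff)
  then obtain m :: int where "2 * pi * of_int k / real n = of_int m * 2 * pi"
    using cos_one_2pi_int by blast
  then have "real_of_int k = of_int (m * int n)" using assms(1) by (simp add: field_simps)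
  then show ?thesis by (simp only: of_int_eq_iff) simp
qed

lemma sum_roots_of_unity_eq_0:
  assumes "n > 0" "\<not> int n dvd k"
  shows "(\<Sum>i=1..n. cis (of_int k * (2 * pi * real i / real n))) = 0"
proof -
  define z where "z = cis (2 * pi * of_int k / real n)"
  have "z \<noteq> 1" using cis_root_of_unity_eq_1 assms by (auto simp: z_def)
  moreover have "z ^ n = cis (2 * pi * of_int k)" using assms by (simp add: z_def Complex.DeMoivre)
  then have "z ^ n = 1" by simp
  ultimately have "(\<Sum>i<n. z ^ i) = 0" by (simp add: geometric_sum)
  then have "(\<Sum>i<n. z ^ Suc i) = 0" by (simp flip: sum_distrib_left)
  then have "(\<Sum>i=1..n. z ^ i) = 0" by (simp add: sum.atLeast1_atMost_eq)
  then show ?thesis by (simp add: z_def Complex.DeMoivre mult_ac)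
qed

text \<open>The weights must be real, so the support is the symmetric pair of residues of
  \<open>j\<close> and \<open>-j\<close> instead of a single class.\<close>

lemma trig_sum_supported_on_residues:
  assumes n: "n > 0"
  obtains c \<theta> where "inj_on (cis \<circ> \<theta>) {1..n}" "\<exists>i\<in>{1..n}. c i \<noteq> 0"
    "\<And>m. trig_sum n c \<theta> m \<noteq> 0 \<Longrightarrow> int n dvd m - j \<or> int n dvd m + j"
proof
  let ?\<theta> = "\<lambda>i. 2 * pi * real i / real n"
  let ?c = "\<lambda>i. cos (of_int j * ?\<theta> i)"
  show "inj_on (cis \<circ> ?\<theta>) {1..n}"
  proof (rule inj_onI)
    fix s t assume st: "s \<in> {1..n}" "t \<in> {1..n}" "(cis \<circ> ?\<theta>) s = (cis \<circ> ?\<theta>) t"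
    then have "cis (?\<theta> s - ?\<theta> t) = 1" by (simp flip: cis_divide)
    then have "cis (2 * pi * of_int (int s - int t) / real n) = 1"
      by (simp add: right_diff_distrib diff_divide_distrib)
    from cis_root_of_unity_eq_1[OF n this] have "int n dvd int s - int t" .
    moreover have "\<bar>int s - int t\<bar> < int n" using st by auto
    ultimately show "s = t" using dvd_imp_le_int[of "int s - int t" "int n"] by fastforce
  qed
  show "\<exists>i\<in>{1..n}. ?c i \<noteq> 0"
  proof
    \<comment> \<open>The index \<open>n\<close> belongs to the angle 2 pi, where the weight is
      1.\<close>
    show "n \<in> {1..n}" using n by simp
    have "?c n = cos (2 * pi * of_int j)" using n by (simp add: mult.commute)
    then show "?c n \<noteq> 0" by (simp add: cos_int_2pin)
  qed
  show "int n dvd m - j \<or> int n dvd m + j" if "trig_sum n ?c ?\<theta> m \<noteq> 0" for m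
  proof (rule ccontr)
    assume "\<not> ?thesis"
    then have 0: "(\<Sum>i=1..n. cis (of_int (m - j) * ?\<theta> i)) = 0" "(\<Sum>i=1..n. cis (of_int (m + j) * ?\<theta> i)) = 0"
      using sum_roots_of_unity_eq_0[OF n] by blast+
    \<comment> \<open>The cosine is the mean of the exponentials of frequency \<open>j\<close> and
      \<open>-j\<close>, so the sum splits into two sums over roots of unity.\<close>
    have "complex_of_real (cos (of_int j * t)) * cis t powi m =
        (cis (of_int (m - j) * t) + cis (of_int (m + j) * t)) / 2" for t
      by (simp add: cis_power_int complex_eq_iff left_diff_distrib distrib_right cos_add cos_diff sin_add sin_diff)
    then have "trig_sum n ?c ?\<theta> m = 0"
      unfolding trig_sum_def by (simp only: sum_divide_distrib[symmetric] sum.distrib 0) simp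
    then show False using that by simp
  qed
qed

theorem theorem2p2:
  fixes f g :: "real \<Rightarrow> real" and a b :: "nat \<Rightarrow> real"
  assumes "isotropic_part_pd f" and "isotropic_part_pd g"
    and "fourier_jacobi_rep f a" and "fourier_jacobi_rep g b"
  shows "isotropic_part_spd (\<lambda>t. f t * g t) \<longleftrightarrow>
    (\<forall>A. full_arith_progression A \<longrightarrow>
       {\<sigma> * int k + \<tau> * int l | (\<sigma> :: int) (\<tau> :: int) (k :: nat) (l :: nat).
          \<sigma> \<in> {1, -1} \<and> \<tau> \<in> {1, -1} \<and> a k * b l > 0} \<inter> A \<noteq> {})"
proof -
  define S where "S = {\<sigma> * int k + \<tau> * int l | (\<sigma> :: int) (\<tau> :: int) (k :: nat) (l :: nat).
          \<sigma> \<in> {1, -1} \<and> \<tau> \<in> {1, -1} \<and> a k * b l > 0}"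
  \<comment> \<open>This symmetry compensates for the test sums, which only locate an element
    congruent to \<open>j\<close> or to \<open>-j\<close>.\<close>
  have S_uminus: "- m \<in> S" if "m \<in> S" for m
  proof -
    from that obtain \<sigma> \<tau> k l where m: "m = \<sigma> * int k + \<tau> * int l" "\<sigma> \<in> {1, -1}" "\<tau> \<in> {1, -1}" "a k * b l > 0"
      unfolding S_def by blast
    then have "- m = (- \<sigma>) * int k + (- \<tau>) * int l" "- \<sigma> \<in> {1, -1}" "- \<tau> \<in> {1, -1}" by auto
    with m(4) show ?thesis unfolding S_def by blast
  qed
  obtain \<alpha> where \<alpha>: "\<And>k. \<alpha> k \<ge> 0" "\<And>k. \<alpha> k > 0 \<longleftrightarrow> a k > 0"
    "\<And>x. (\<lambda>k. \<alpha> k * cos (real k * x)) sums f (cos x)"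
    using fourier_jacobi_rep_cosine_series[OF assms(3)] by blast
  obtain \<beta> where \<beta>: "\<And>k. \<beta> k \<ge> 0" "\<And>k. \<beta> k > 0 \<longleftrightarrow> b k > 0"
    "\<And>x. (\<lambda>k. \<beta> k * cos (real k * x)) sums g (cos x)"
    using fourier_jacobi_rep_cosine_series[OF assms(4)] by blast
  have ab: "a k * b l > 0 \<longleftrightarrow> \<alpha> k > 0 \<and> \<beta> l > 0" for k l
    using assms(3,4) unfolding fourier_jacobi_rep_def
    by (metis \<alpha>(2) \<beta>(2) less_le mult_pos_pos mult_zero_left mult_zero_right)
  note form = product_quadratic_form_pos_iff[OF \<alpha>(1,3) \<beta>(1,3)]
  have form_pos: "(\<Sum>i=1..n. \<Sum>j=1..n. c i * c j * (f (cos (\<theta> i - \<theta> j)) * g (cos (\<theta> i - \<theta> j)))) > 0 \<longleftrightarrow>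
      (\<exists>m\<in>S. trig_sum n c \<theta> m \<noteq> 0)" for n c \<theta>
    unfolding form(2)
  proof
    assume "\<exists>k l. \<alpha> k > 0 \<and> \<beta> l > 0 \<and>
      (trig_sum n c \<theta> (int k + int l) \<noteq> 0 \<or> trig_sum n c \<theta> (int k - int l) \<noteq> 0)"
    then obtain k l where kl: "a k * b l > 0"
      "trig_sum n c \<theta> (1 * int k + 1 * int l) \<noteq> 0 \<or> trig_sum n c \<theta> (1 * int k + (-1) * int l) \<noteq> 0"
      unfolding ab by auto
    then show "\<exists>m\<in>S. trig_sum n c \<theta> m \<noteq> 0" unfolding S_def by blast
  next
    assume "\<exists>m\<in>S. trig_sum n c \<theta> m \<noteq> 0"
    then obtain \<sigma> \<tau> k l where m: "\<sigma> \<in> {1, -1}" "\<tau> \<in> {1, -1}" "a k * b l > 0"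
      "trig_sum n c \<theta> (\<sigma> * int k + \<tau> * int l) \<noteq> 0"
      unfolding S_def by blast
    \<comment> \<open>Negating a frequency conjugates the sum, so the four sign choices reduce to k
      + l and k - l.\<close>
    then have "trig_sum n c \<theta> (int k + int l) \<noteq> 0 \<or> trig_sum n c \<theta> (int k - int l) \<noteq> 0"
      using trig_sum_uminus[of n c \<theta> "int k + int l"] trig_sum_uminus[of n c \<theta> "int k - int l"]
      by auto
    with m(3) show "\<exists>k l. \<alpha> k > 0 \<and> \<beta> l > 0 \<and>
      (trig_sum n c \<theta> (int k + int l) \<noteq> 0 \<or> trig_sum n c \<theta> (int k - int l) \<noteq> 0)"
      unfolding ab by blast
  qed
  have "continuous_on {-1..1} (\<lambda>t. f t * g t)"
    using assms(1,2) by (simp add: isotropic_part_pd_def continuous_on_mult)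
  from isotropic_part_spd_angles[OF this form(1)]
  have "isotropic_part_spd (\<lambda>t. f t * g t) \<longleftrightarrow>
    (\<forall>n c \<theta>. inj_on (cis \<circ> \<theta>) {1..n} \<longrightarrow> (\<exists>i\<in>{1..n}. c i \<noteq> 0) \<longrightarrow> (\<exists>m\<in>S. trig_sum n c \<theta> m \<noteq> 0))"
    by (simp only: form_pos)
  also have "\<dots> \<longleftrightarrow> (\<forall>A. full_arith_progression A \<longrightarrow> S \<inter> A \<noteq> {})"
  proof (intro iffI allI impI)
    fix A
    assume trig: "\<forall>n c \<theta>. inj_on (cis \<circ> \<theta>) {1..n} \<longrightarrow> (\<exists>i\<in>{1..n}. c i \<noteq> 0) \<longrightarrow>
        (\<exists>m\<in>S. trig_sum n c \<theta> m \<noteq> 0)"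
      and "full_arith_progression A"
    then obtain n j :: nat where A: "n \<ge> 2" "A = {int n * l + int j | l. True}"
      unfolding full_arith_progression_def by blast
    have "n > 0" using A by simp
    then obtain c \<theta> where c: "inj_on (cis \<circ> \<theta>) {1..n}" "\<exists>i\<in>{1..n}. c i \<noteq> 0"
      "\<And>m. trig_sum n c \<theta> m \<noteq> 0 \<Longrightarrow> int n dvd m - int j \<or> int n dvd m + int j"
      using trig_sum_supported_on_residues[of n "int j"] by metis
    then obtain m where m: "m \<in> S" "trig_sum n c \<theta> m \<noteq> 0" using trig by blast
    have "m \<in> A \<or> - m \<in> A"
      using c(3)[OF m(2)]
    proof
      assume "int n dvd m - int j"
      then obtain l where "m - int j = int n * l" by (elim dvdE)
      then have "m = int n * l + int j" by simp
      then show ?thesis using A by blast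
    next
      assume "int n dvd m + int j"
      then obtain l where "m + int j = int n * l" by (elim dvdE)
      then have "- m = int n * (- l) + int j" by simp
      then show ?thesis using A by blast
    qed
    then show "S \<inter> A \<noteq> {}" using m S_uminus by blast
  next
    fix n :: nat and c \<theta> :: "nat \<Rightarrow> real"
    assume "\<forall>A. full_arith_progression A \<longrightarrow> S \<inter> A \<noteq> {}"
      and "inj_on (cis \<circ> \<theta>) {1..n}" "\<exists>i\<in>{1..n}. c i \<noteq> 0"
    then show "\<exists>m\<in>S. trig_sum n c \<theta> m \<noteq> 0"
      using trig_sum_nonzero_on_progression[of \<theta> n _ c] by blast
  qed
  finally show ?thesis unfolding S_def .
qed

end
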